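(* Suppose $D\subsetneq\mathbb{C}$ is a simply connected domain containing $0$. Let $a\in[-\infty,0)$ and $b\in(0,\infty]$ be such that $\{\operatorname{Re} z:z\in D\}=(a,b)$, and define \[ \alpha=\sup\left\{x\in\mathbb{R}:\mathbb{P}_0\big(\operatorname{Re} W_{\tau_D}\in[x,\infty)\big)=1\right\}, \qquad \beta=\inf\left\{x\in\mathbb{R}:\mathbb{P}_0\big(\operatorname{Re} W_{\tau_D}\in(-\infty,x]\big)=1\right\}. \] Then $a>-\infty$ implies $\alpha=a$, and $b<\infty$ implies $\beta=b$. Moreover, if $\mathbb{E}_0[\tau_D]<\infty$, then $\alpha=a$ and $\beta=b$ regardless of whether $a$ and $b$ are finite.
   Context: $W=(W_t:t\ge0)$ is a standard complex Brownian motion, started at $0$ under $\mathbb{P}_0$, and $\tau_D=\inf\{t\ge0:W_t\notin D\}$ is its first exit time from $D$ (almost surely finite under the assumptions on $D$). Conventions: $\sup\emptyset=-\infty$ and $\inf\emptyset=+\infty$. The projection $\{\operatorname{Re} z:z\in D\}$ is an open interval containing $0$ since $D$ is open and connected and contains $0$. *)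

theory Defs
  imports "HOL-Probability.Probability"
begin

locale standard_brownian_motion = prob_space M
  for M :: "'w measure" and B :: "real \<Rightarrow> 'w \<Rightarrow> real" +
  assumes random_variable: "\<And>t. t \<ge> 0 \<Longrightarrow> random_variable borel (B t)"
    and start: "AE \<omega> in M. B 0 \<omega> = 0"
    and normal_increments:
      "\<And>s t. 0 \<le> s \<Longrightarrow> s < t \<Longrightarrow>
         distributed M lborel (\<lambda>\<omega>. B t \<omega> - B s \<omega>) (normal_density 0 (sqrt (t - s)))"
    and indep_increments:
      "\<And>(u :: nat \<Rightarrow> real) n. 0 \<le> u 0 \<Longrightarrow> mono u \<Longrightarrow>
         indep_vars (\<lambda>_. borel) (\<lambda>i \<omega>. B (u (Suc i)) \<omega> - B (u i) \<omega>) {..<n}"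
    and continuous_paths: "\<And>\<omega>. \<omega> \<in> space M \<Longrightarrow> continuous_on {0..} (\<lambda>t. B t \<omega>)"

text \<open>
  Real and imaginary part are independent as processes, i.e. as random elements of the product
  space of all real functions on the time axis. In this normalisation the variance of
  \<open>W\<^sub>t\<close> is \<open>2 t\<close>.
\<close>

locale complex_brownian_motion = prob_space M
  for M :: "'w measure" and W :: "real \<Rightarrow> 'w \<Rightarrow> complex" +
  assumes Re_brownian: "standard_brownian_motion M (\<lambda>t \<omega>. Re (W t \<omega>))"
    and Im_brownian: "standard_brownian_motion M (\<lambda>t \<omega>. Im (W t \<omega>))"
    and indep_Re_Im:
      "indep_var (PiM {0..} (\<lambda>_. borel)) (\<lambda>\<omega>. \<lambda>t\<in>{0..}. Re (W t \<omega>))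
                 (PiM {0..} (\<lambda>_. borel)) (\<lambda>\<omega>. \<lambda>t\<in>{0..}. Im (W t \<omega>))"

definition exit_time :: "(real \<Rightarrow> 'w \<Rightarrow> complex) \<Rightarrow> complex set \<Rightarrow> 'w \<Rightarrow> ennreal" where
  "exit_time W D \<omega> = Inf (ennreal ` {t. 0 \<le> t \<and> W t \<omega> \<notin> D})"

text \<open>
  The position at the exit time is only meaningful where the exit time is finite, so finiteness
  is part of the event that the exit position has real part in \<open>A\<close>.
\<close>

definition exit_Re_event ::
  "'w measure \<Rightarrow> (real \<Rightarrow> 'w \<Rightarrow> complex) \<Rightarrow> complex set \<Rightarrow> real set \<Rightarrow> 'w set" where
  "exit_Re_event M W D A =
     {\<omega> \<in> space M. exit_time W D \<omega> < \<infinity> \<and> Re (W (enn2real (exit_time W D \<omega>)) \<omega>) \<in> A}"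

end

theory Submission
  imports Defs
begin

text \<open>
  Write \<open>\<tau>\<close> for the exit time. By reflection in the origin it suffices to treat \<open>\<alpha>\<close> and \<open>a\<close>.

  If \<open>a\<close> is finite, the exit time is finite because the real part of the motion falls below every
  level (\<open>AE_below_level\<close>), and the exit position is a limit of points of \<open>D\<close>, so that its real part is
  at least \<open>a\<close>. This is the inequality \<open>a \<le> \<alpha>\<close>, which is trivial if \<open>a\<close> is infinite. The other inequality
  says that for every \<open>x > a\<close> the exit takes place to the left of \<open>x\<close> with positive probability. It
  rests on the fact that a planar Brownian motion has a positive chance of getting close to any given
  point of a domain before leaving it (\<open>reachable_everywhere\<close>), used in two ways.

  If \<open>a\<close> is finite, this is applied to the union of \<open>D\<close> with the half-plane \<open>{z. Re z < x}\<close>, and to a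
  target to the left of \<open>a\<close>, thus outside \<open>D\<close>. A path that arrives there within the union has left
  \<open>D\<close>, and at a point of the half-plane.

  If the mean of \<open>\<tau>\<close> is finite, this is applied to \<open>D\<close> itself, and to a target in \<open>D\<close> to the left of \<open>x\<close>.
  The real part of the motion stopped at \<open>\<tau>\<close> is a martingale bounded in \<open>L\<^sup>2\<close>, so if its terminal value
  were almost surely at least \<open>x\<close>, then so would be all its earlier values
  (\<open>stopped_Re_lower_bound\<close>), and the target could not be approached.

  Reachability is proved without a support theorem for paths. The reachable points of a domain
  form a relatively closed set, and a reachable point closest to a hypothetical unreachable one is
  impossible: over a short time \<open>h\<close> the motion makes a step of length about \<open>sqrt h\<close> in a prescribed
  direction with a probability independent of \<open>h\<close>, while the probability that it strays far
  meanwhile is of order \<open>h\<close> by Kolmogorov's inequality. That inequality and the martingale argument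
  both come from one computation, the first two moments of a sum of increments restricted to events
  from the past (\<open>predictable_sum_moments\<close>).
\<close>

section \<open>The history of the motion and the independence of later increments\<close>

definition past :: "'w measure \<Rightarrow> (real \<Rightarrow> 'w \<Rightarrow> complex) \<Rightarrow> real \<Rightarrow> 'w measure" where
  "past M W t = sigma (space M) {W s -` S \<inter> space M | s S. 0 \<le> s \<and> s \<le> t \<and> S \<in> sets borel}"

lemma space_past [simp]: "space (past M W t) = space M"
  unfolding past_def by (rule space_measure_of) auto

lemma sets_past:
  "sets (past M W t) = sigma_sets (space M) {W s -` S \<inter> space M | s S. 0 \<le> s \<and> s \<le> t \<and> S \<in> sets borel}"
  unfolding past_def by (rule sets_measure_of) auto

lemma measurable_past:
  assumes "0 \<le> s" "s \<le> t"
  shows "W s \<in> borel_measurable (past M W t)"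
  using assms by (intro measurableI) (auto simp: sets_past)

lemma past_mono:
  assumes "s \<le> t"
  shows "sets (past M W s) \<subseteq> sets (past M W t)"
  unfolding sets_past using assms by (intro sigma_sets_mono') force

lemma measurable_sets_Collect_mem:
  assumes "f \<in> measurable M N" "S \<in> sets N"
  shows "{x \<in> space M. f x \<in> S} \<in> sets M"
  using measurable_sets[OF assms] by (simp add: vimage_def Int_def conj_commute)

text \<open>
  The increments of Brownian motion are given as independent along increasing sequences of times,
  so a finite set of observation times has to be listed in increasing order, starting from 0 and
  followed by the two end points of the increment in question.
\<close>

lemma ex_mono_enumeration:
  fixes J :: "real set"
  assumes "finite J" "J \<subseteq> {0..t}" "t \<le> v" "0 \<le> t"
  obtains u :: "nat \<Rightarrow> real" and n where "mono u" "u 0 = 0" "u n = t" "u (Suc n) = v"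
    "J \<subseteq> u ` {..n}"
proof -
  define l where "l = sorted_list_of_set (insert 0 J)"
  have l: "sorted l" "set l = insert 0 J"
    using assms by (auto simp: l_def simp del: sorted_list_of_set_insert_remove)
  have len: "0 < length l" using l(2) by (cases l) auto
  define u where "u i = (if i < length l then l ! i else if i = length l then t else v)" for i
  have bnd: "0 \<le> l ! i" "l ! i \<le> t" if "i < length l" for i
  proof -
    have "l ! i \<in> insert 0 J" using that nth_mem l(2) by blast
    then show "0 \<le> l ! i" "l ! i \<le> t" using assms by auto
  qed
  have "mono u"
    unfolding mono_def using bnd assms(3) l(1)
    by (auto simp: u_def sorted_nth_mono intro: order_trans)
  moreover have "u 0 = 0"
  proof -
    obtain i where i: "i < length l" "l ! i = 0"
      using l(2) by (metis in_set_conv_nth insertI1)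
    then have "l ! 0 \<le> 0" using sorted_nth_mono[OF l(1), of 0 i] by simp
    then show ?thesis using bnd(1)[OF len] len by (simp add: u_def)
  qed
  moreover have "J \<subseteq> u ` {..length l}"
  proof
    fix j assume "j \<in> J"
    then obtain i where "i < length l" "l ! i = j"
      using l(2) by (metis in_set_conv_nth insertCI)
    then show "j \<in> u ` {..length l}" by (intro image_eqI[of _ _ i]) (auto simp: u_def)
  qed
  ultimately show thesis
    by (intro that[of u "length l"]) (auto simp: u_def)
qed

context standard_brownian_motion
begin

text \<open>
  Almost surely the motion starts at 0, and then its values at earlier times are partial sums of
  earlier increments. An event about them is therefore an event about a tuple of increments that is
  independent of the later one.
\<close>

lemma increment_indep_cylinder:
  assumes J: "finite J" "J \<subseteq> {0..t}" and S: "\<And>j. j \<in> J \<Longrightarrow> S j \<in> sets borel"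
    and tv: "0 \<le> t" "t \<le> v" and C: "C \<in> sets borel"
  shows "prob {\<omega> \<in> space M. (\<forall>j\<in>J. B j \<omega> \<in> S j) \<and> B v \<omega> - B t \<omega> \<in> C}
       = prob {\<omega> \<in> space M. \<forall>j\<in>J. B j \<omega> \<in> S j} * prob {\<omega> \<in> space M. B v \<omega> - B t \<omega> \<in> C}"
proof -
  obtain u n where u: "mono u" "u 0 = 0" "u n = t" "u (Suc n) = v" "J \<subseteq> u ` {..n}"
    using ex_mono_enumeration[OF J tv(2,1)] by blast
  have u0: "0 \<le> u i" for i using u(1,2) by (metis monoD le0)
  define d where "d i \<omega> = B (u (Suc i)) \<omega> - B (u i) \<omega>" for i \<omega>
  have [measurable]: "B (u i) \<in> borel_measurable M" for i
    using random_variable[OF u0] .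
  have "indep_vars (\<lambda>_. borel) d {..<Suc n}"
    unfolding d_def using indep_increments[of u "Suc n"] u by simp
  then have ind: "indep_var (PiM {..<n} (\<lambda>_. borel)) (\<lambda>\<omega>. restrict (\<lambda>i. d i \<omega>) {..<n})
        (PiM {n} (\<lambda>_. borel)) (\<lambda>\<omega>. restrict (\<lambda>i. d i \<omega>) {n})"
    by (rule indep_var_restrict) auto
  \<comment> \<open>On the event where the motion starts at 0, its values are the partial sums of the increments.\<close>
  have sumd: "(\<Sum>k<i. d k \<omega>) = B (u i) \<omega> - B 0 \<omega>" for i \<omega>
    unfolding d_def using u(2) by (subst sum_lessThan_telescope) simp
  define I where "I = {i. i \<le> n \<and> u i \<in> J}"
  have finI: "finite I" unfolding I_def by simp
  define E1 where "E1 = {f \<in> space (PiM {..<n} (\<lambda>_. borel :: real measure)). \<forall>i\<in>I. (\<Sum>k<i. f k) \<in> S (u i)}"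
  define E2 where "E2 = {f \<in> space (PiM {n} (\<lambda>_. borel :: real measure)). f n \<in> C}"
  have E1: "E1 \<in> sets (PiM {..<n} (\<lambda>_. borel))"
  proof -
    have "(\<lambda>f. \<Sum>k<i. f k) \<in> borel_measurable (PiM {..<n} (\<lambda>_. borel :: real measure))" if "i \<in> I" for i
      using that by (intro borel_measurable_sum measurable_component_singleton) (auto simp: I_def)
    then have "{f \<in> space (PiM {..<n} (\<lambda>_. borel :: real measure)). (\<Sum>k<i. f k) \<in> S (u i)} \<in> sets (PiM {..<n} (\<lambda>_. borel))"
      if "i \<in> I" for i
      using that S by (intro measurable_sets_Collect_mem[of _ _ borel]) (auto simp: I_def)
    then show ?thesis unfolding E1_def by (intro sets.sets_Collect_finite_All finI) auto
  qed
  have E2: "E2 \<in> sets (PiM {n} (\<lambda>_. borel))"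
    unfolding E2_def using C
    by (intro measurable_sets_Collect_mem[of _ _ borel] measurable_component_singleton) auto
  have sp1: "restrict (\<lambda>i. d i \<omega>) A \<in> space (PiM A (\<lambda>_. borel))" for \<omega> A
    by (simp add: space_PiM)
  have past_sum: "restrict (\<lambda>i. d i \<omega>) {..<n} \<in> E1 \<longleftrightarrow> (\<forall>j\<in>J. B j \<omega> \<in> S j)"
    if "B 0 \<omega> = 0" for \<omega>
  proof -
    have "(\<Sum>k<i. restrict (\<lambda>i. d i \<omega>) {..<n} k) = B (u i) \<omega>" if "i \<in> I" for i
    proof -
      have "(\<Sum>k<i. restrict (\<lambda>i. d i \<omega>) {..<n} k) = (\<Sum>k<i. d k \<omega>)"
        using that by (intro sum.cong) (auto simp: I_def)
      then show ?thesis using sumd \<open>B 0 \<omega> = 0\<close> by simp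
    qed
    then have "restrict (\<lambda>i. d i \<omega>) {..<n} \<in> E1 \<longleftrightarrow> (\<forall>i\<in>I. B (u i) \<omega> \<in> S (u i))"
      using sp1[of \<omega> "{..<n}"] by (auto simp: E1_def)
    also have "\<dots> \<longleftrightarrow> (\<forall>j\<in>J. B j \<omega> \<in> S j)" using u(5) by (auto simp: I_def)
    finally show ?thesis .
  qed
  have fut: "restrict (\<lambda>i. d i \<omega>) {n} \<in> E2 \<longleftrightarrow> B v \<omega> - B t \<omega> \<in> C" for \<omega>
    using sp1[of \<omega> "{n}"] u by (simp add: E2_def d_def)
  have J0: "0 \<le> j" if "j \<in> J" for j using J that by auto
  have mJ: "{\<omega> \<in> space M. \<forall>j\<in>J. B j \<omega> \<in> S j} \<in> events"
    using J0 S random_variable J(1)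
    by (intro sets.sets_Collect_finite_All measurable_sets_Collect_mem[of _ _ borel]) auto
  have mC: "{\<omega> \<in> space M. B v \<omega> - B t \<omega> \<in> C} \<in> events"
    using random_variable tv C by (intro measurable_sets_Collect_mem[of _ _ borel]) auto
  have Z1: "random_variable (PiM {..<n} (\<lambda>_. borel)) (\<lambda>\<omega>. restrict (\<lambda>i. d i \<omega>) {..<n})"
    and Z2: "random_variable (PiM {n} (\<lambda>_. borel)) (\<lambda>\<omega>. restrict (\<lambda>i. d i \<omega>) {n})"
    using ind unfolding indep_var_eq by auto
  let ?F1 = "(\<lambda>\<omega>. restrict (\<lambda>i. d i \<omega>) {..<n}) -` E1 \<inter> space M"
  let ?F2 = "(\<lambda>\<omega>. restrict (\<lambda>i. d i \<omega>) {n}) -` E2 \<inter> space M"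
  have mF: "?F1 \<in> events" "?F2 \<in> events"
    using Z1 Z2 E1 E2 by (auto intro: measurable_sets)
  have "prob (?F1 \<inter> ?F2) = prob ?F1 * prob ?F2"
    using indep_varD[OF ind E1 E2] by (simp add: Times_Int_Times vimage_def Int_def conj_ac)
  moreover have "prob ?F1 = prob {\<omega> \<in> space M. \<forall>j\<in>J. B j \<omega> \<in> S j}"
    using start mF mJ past_sum by (intro finite_measure_eq_AE) auto
  moreover have "?F2 = {\<omega> \<in> space M. B v \<omega> - B t \<omega> \<in> C}" using fut by auto
  moreover have "prob (?F1 \<inter> ?F2) = prob ({\<omega> \<in> space M. \<forall>j\<in>J. B j \<omega> \<in> S j} \<inter> {\<omega> \<in> space M. B v \<omega> - B t \<omega> \<in> C})"
    using start mF mJ mC past_sum fut by (intro finite_measure_eq_AE) auto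
  moreover have "{\<omega> \<in> space M. \<forall>j\<in>J. B j \<omega> \<in> S j} \<inter> {\<omega> \<in> space M. B v \<omega> - B t \<omega> \<in> C}
      = {\<omega> \<in> space M. (\<forall>j\<in>J. B j \<omega> \<in> S j) \<and> B v \<omega> - B t \<omega> \<in> C}" by auto
  ultimately show ?thesis by simp
qed

end

context complex_brownian_motion
begin

sublocale re: standard_brownian_motion M "\<lambda>t \<omega>. Re (W t \<omega>)" by (rule Re_brownian)
sublocale im: standard_brownian_motion M "\<lambda>t \<omega>. Im (W t \<omega>)" by (rule Im_brownian)

lemma measurable_W: "0 \<le> t \<Longrightarrow> W t \<in> borel_measurable M"
  using re.random_variable im.random_variable by (simp add: borel_measurable_complex_iff)

lemma past_events: "0 \<le> t \<Longrightarrow> sets (past M W t) \<subseteq> events"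
  unfolding sets_past using measurable_W by (intro sets.sigma_sets_subset) (auto intro: measurable_sets)

lemma start_W: "AE \<omega> in M. W 0 \<omega> = 0"
  using re.start im.start by eventually_elim (simp add: complex_eq_iff)

lemma continuous_W: "\<omega> \<in> space M \<Longrightarrow> continuous_on {0..} (\<lambda>t. W t \<omega>)"
  using continuous_on_Complex[OF re.continuous_paths im.continuous_paths, of \<omega> \<omega>] by simp

lemma indep_Re_Im_finite:
  assumes J: "finite J" "J \<subseteq> {0..}" and P: "P \<in> sets (PiM J (\<lambda>_. borel))"
    and Q: "Q \<in> sets (PiM J (\<lambda>_. borel))"
  shows "prob {\<omega> \<in> space M. (\<lambda>t\<in>J. Re (W t \<omega>)) \<in> P \<and> (\<lambda>t\<in>J. Im (W t \<omega>)) \<in> Q}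
       = prob {\<omega> \<in> space M. (\<lambda>t\<in>J. Re (W t \<omega>)) \<in> P} * prob {\<omega> \<in> space M. (\<lambda>t\<in>J. Im (W t \<omega>)) \<in> Q}"
proof -
  have m: "(\<lambda>f. restrict f J) \<in> measurable (PiM {0..} (\<lambda>_. borel)) (PiM J (\<lambda>_. borel :: real measure))"
    using J by (intro measurable_restrict_subset) auto
  have r: "restrict (restrict f {0..}) J = restrict f J" for f :: "real \<Rightarrow> real"
    using J by (auto simp: restrict_def fun_eq_iff)
  have "{0..} \<inter> J = J" using J by auto
  then have "indep_var (PiM J (\<lambda>_. borel)) (\<lambda>\<omega>. \<lambda>t\<in>J. Re (W t \<omega>)) (PiM J (\<lambda>_. borel)) (\<lambda>\<omega>. \<lambda>t\<in>J. Im (W t \<omega>))"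
    using indep_var_compose[OF indep_Re_Im m m] by (simp add: comp_def r)
  from indep_varD[OF this P Q] show ?thesis
    by (simp add: vimage_def Int_def conj_ac)
qed

text \<open>
  Independence of the coordinates splits the event into a real and an imaginary part, and within
  each coordinate the increment is independent of the history.
\<close>

lemma prob_cylinder_and_increment:
  assumes J: "finite J" "J \<subseteq> {0..t}" and t: "0 \<le> t" "t \<le> v"
    and S: "\<And>j. j \<in> J \<Longrightarrow> S j \<in> sets borel" "\<And>j. j \<in> J \<Longrightarrow> S' j \<in> sets borel"
    and C: "C \<in> sets borel" "C' \<in> sets borel"
  shows "prob {\<omega> \<in> space M. (\<forall>j\<in>J. Re (W j \<omega>) \<in> S j \<and> Im (W j \<omega>) \<in> S' j) \<and>
                Re (W v \<omega>) - Re (W t \<omega>) \<in> C \<and> Im (W v \<omega>) - Im (W t \<omega>) \<in> C'}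
      = (prob {\<omega> \<in> space M. \<forall>j\<in>J. Re (W j \<omega>) \<in> S j} * prob {\<omega> \<in> space M. Re (W v \<omega>) - Re (W t \<omega>) \<in> C})
      * (prob {\<omega> \<in> space M. \<forall>j\<in>J. Im (W j \<omega>) \<in> S' j} * prob {\<omega> \<in> space M. Im (W v \<omega>) - Im (W t \<omega>) \<in> C'})"
proof -
  define K where "K = insert t (insert v J)"
  have K: "finite K" "K \<subseteq> {0..}" using J t by (auto simp: K_def)
  define P where "P U c = {f \<in> space (PiM K (\<lambda>_. borel :: real measure)). (\<forall>j\<in>J. f j \<in> U j) \<and> f v - f t \<in> c}"
    for U and c :: "real set"
  have P: "P U c \<in> sets (PiM K (\<lambda>_. borel))" if "\<And>j. j \<in> J \<Longrightarrow> U j \<in> sets borel" "c \<in> sets borel" for U c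
    unfolding P_def using that J(1)
    by (intro sets.sets_Collect_conj sets.sets_Collect_finite_All measurable_sets_Collect_mem[of _ _ borel]
          borel_measurable_diff measurable_component_singleton) (auto simp: K_def)
  have sp: "(\<lambda>t\<in>K. g t) \<in> space (PiM K (\<lambda>_. borel))" for g :: "real \<Rightarrow> real"
    by (simp add: space_PiM)
  have mem: "(\<lambda>t\<in>K. g t) \<in> P U c \<longleftrightarrow> (\<forall>j\<in>J. g j \<in> U j) \<and> g v - g t \<in> c" for g U c
    using sp by (auto simp: P_def K_def)
  have "prob {\<omega> \<in> space M. (\<lambda>t\<in>K. Re (W t \<omega>)) \<in> P S C \<and> (\<lambda>t\<in>K. Im (W t \<omega>)) \<in> P S' C'}
     = prob {\<omega> \<in> space M. (\<lambda>t\<in>K. Re (W t \<omega>)) \<in> P S C} * prob {\<omega> \<in> space M. (\<lambda>t\<in>K. Im (W t \<omega>)) \<in> P S' C'}"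
    using S C by (intro indep_Re_Im_finite K P) auto
  also have "{\<omega> \<in> space M. (\<lambda>t\<in>K. Re (W t \<omega>)) \<in> P S C \<and> (\<lambda>t\<in>K. Im (W t \<omega>)) \<in> P S' C'}
    = {\<omega> \<in> space M. (\<forall>j\<in>J. Re (W j \<omega>) \<in> S j \<and> Im (W j \<omega>) \<in> S' j) \<and>
                Re (W v \<omega>) - Re (W t \<omega>) \<in> C \<and> Im (W v \<omega>) - Im (W t \<omega>) \<in> C'}"
    unfolding mem by auto
  also have "prob {\<omega> \<in> space M. (\<lambda>t\<in>K. Re (W t \<omega>)) \<in> P S C}
      = prob {\<omega> \<in> space M. \<forall>j\<in>J. Re (W j \<omega>) \<in> S j} * prob {\<omega> \<in> space M. Re (W v \<omega>) - Re (W t \<omega>) \<in> C}"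
    unfolding mem using J S C t by (intro re.increment_indep_cylinder) auto
  also have "prob {\<omega> \<in> space M. (\<lambda>t\<in>K. Im (W t \<omega>)) \<in> P S' C'}
      = prob {\<omega> \<in> space M. \<forall>j\<in>J. Im (W j \<omega>) \<in> S' j} * prob {\<omega> \<in> space M. Im (W v \<omega>) - Im (W t \<omega>) \<in> C'}"
    unfolding mem using J S C t by (intro im.increment_indep_cylinder) auto
  finally show ?thesis .
qed

text \<open>
  Cylinder events are closed under intersection and generate the history, so the product formula
  extends to all of it. Treating both coordinates at once matters: the history contains both paths,
  and the exit from a planar domain depends on both.
\<close>

lemma increment_indep_past:
  assumes A: "A \<in> sets (past M W t)" and t: "0 \<le> t" "t \<le> v"
    and C: "C \<in> sets borel" "C' \<in> sets borel"
  shows "prob (A \<inter> {\<omega> \<in> space M. Re (W v \<omega>) - Re (W t \<omega>) \<in> C \<and> Im (W v \<omega>) - Im (W t \<omega>) \<in> C'})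
    = prob A * (prob {\<omega> \<in> space M. Re (W v \<omega>) - Re (W t \<omega>) \<in> C}
              * prob {\<omega> \<in> space M. Im (W v \<omega>) - Im (W t \<omega>) \<in> C'})"
proof -
  define cyl where "cyl J S S' = {\<omega> \<in> space M. \<forall>j\<in>J. Re (W j \<omega>) \<in> S j \<and> Im (W j \<omega>) \<in> S' j}"
    for J and S S' :: "real \<Rightarrow> real set"
  define G where "G = {cyl J S S' | J S S'. finite J \<and> J \<subseteq> {0..t} \<and>
      (\<forall>j. S j \<in> sets borel) \<and> (\<forall>j. S' j \<in> sets borel)}"
  let ?E = "{\<omega> \<in> space M. Re (W v \<omega>) - Re (W t \<omega>) \<in> C \<and> Im (W v \<omega>) - Im (W t \<omega>) \<in> C'}"
  have mRe: "(\<lambda>\<omega>. Re (W s \<omega>)) \<in> borel_measurable M" "(\<lambda>\<omega>. Im (W s \<omega>)) \<in> borel_measurable M"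
    if "0 \<le> s" for s using re.random_variable im.random_variable that by auto
  have E: "?E \<in> events"
    using t C mRe
    by (intro sets.sets_Collect_conj measurable_sets_Collect_mem[of _ _ borel] borel_measurable_diff) auto
  have Gev: "G \<subseteq> events"
    unfolding G_def cyl_def using mRe
    by (auto intro!: sets.sets_Collect_finite_All sets.sets_Collect_conj measurable_sets_Collect_mem[of _ _ borel])
  have ind: "indep_set G {?E}"
  proof (rule indep_setI)
    fix a b assume "a \<in> G" "b \<in> {?E}"
    then obtain J S S' where a: "a = cyl J S S'" and b: "b = ?E" and J: "finite J" "J \<subseteq> {0..t}"
      and S: "\<And>j. S j \<in> sets borel" "\<And>j. S' j \<in> sets borel" unfolding G_def by auto
    have "prob a = prob {\<omega> \<in> space M. \<forall>j\<in>J. Re (W j \<omega>) \<in> S j} * prob {\<omega> \<in> space M. \<forall>j\<in>J. Im (W j \<omega>) \<in> S' j}"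
      using prob_cylinder_and_increment[OF J t, of S S' UNIV UNIV] S by (simp add: a cyl_def prob_space)
    moreover have "prob b = prob {\<omega> \<in> space M. Re (W v \<omega>) - Re (W t \<omega>) \<in> C}
              * prob {\<omega> \<in> space M. Im (W v \<omega>) - Im (W t \<omega>) \<in> C'}"
      using prob_cylinder_and_increment[of "{}" t v, OF _ _ t _ _ C] by (simp add: b prob_space)
    moreover have "a \<inter> b = {\<omega> \<in> space M. (\<forall>j\<in>J. Re (W j \<omega>) \<in> S j \<and> Im (W j \<omega>) \<in> S' j) \<and>
                Re (W v \<omega>) - Re (W t \<omega>) \<in> C \<and> Im (W v \<omega>) - Im (W t \<omega>) \<in> C'}"
      by (auto simp: a b cyl_def)
    ultimately show "prob (a \<inter> b) = prob a * prob b"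
      using prob_cylinder_and_increment[OF J t, of S S' C C'] S C by simp
  qed (use Gev E in auto)
  have stab: "Int_stable G"
  proof (rule Int_stableI)
    fix a b assume "a \<in> G" "b \<in> G"
    then obtain J S S' K U U' where a: "a = cyl J S S'" "finite J" "J \<subseteq> {0..t}"
      "\<And>j. S j \<in> sets borel" "\<And>j. S' j \<in> sets borel"
      and b: "b = cyl K U U'" "finite K" "K \<subseteq> {0..t}" "\<And>j. U j \<in> sets borel" "\<And>j. U' j \<in> sets borel"
      unfolding G_def by blast
    define m where "m S U = (\<lambda>j. (if j \<in> J then S j else UNIV) \<inter> (if j \<in> K then U j else UNIV))"
      for S U :: "real \<Rightarrow> real set"
    have "a \<inter> b = cyl (J \<union> K) (m S U) (m S' U')"
      unfolding a b cyl_def m_def by auto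
    moreover have "m S U j \<in> sets borel" "m S' U' j \<in> sets borel" for j
      using a b by (auto simp: m_def)
    ultimately show "a \<inter> b \<in> G" unfolding G_def using a b
      by (intro CollectI exI[of _ "J \<union> K"] exI[of _ "m S U"] exI[of _ "m S' U'"]) auto
  qed
  have "indep_set (sigma_sets (space M) G) (sigma_sets (space M) {?E})"
    using ind stab by (rule indep_set_sigma_sets) (simp add: Int_stable_def)
  moreover have "A \<in> sigma_sets (space M) G"
  proof -
    have Gsub: "G \<subseteq> Pow (space M)" unfolding G_def cyl_def by auto
    let ?N = "sigma (space M) G"
    have "W s -` S \<inter> space M \<in> sigma_sets (space M) G" if "0 \<le> s" "s \<le> t" "S \<in> sets borel" for s S
    proof -
      have "cyl {s} (\<lambda>_. R) (\<lambda>_. UNIV) \<in> G" "cyl {s} (\<lambda>_. UNIV) (\<lambda>_. R) \<in> G" if "R \<in> sets borel" for R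
        unfolding G_def using that \<open>0 \<le> s\<close> \<open>s \<le> t\<close> by force+
      moreover have "cyl {s} (\<lambda>_. R) (\<lambda>_. UNIV) = (\<lambda>\<omega>. Re (W s \<omega>)) -` R \<inter> space M"
        "cyl {s} (\<lambda>_. UNIV) (\<lambda>_. R) = (\<lambda>\<omega>. Im (W s \<omega>)) -` R \<inter> space M" for R
        by (auto simp: cyl_def)
      ultimately have "(\<lambda>\<omega>. Re (W s \<omega>)) \<in> borel_measurable ?N" "(\<lambda>\<omega>. Im (W s \<omega>)) \<in> borel_measurable ?N"
        using Gsub by (auto intro!: measurableI simp: sets_measure_of space_measure_of)
      then have "W s \<in> borel_measurable ?N" by (simp add: borel_measurable_complex_iff)
      from measurable_sets[OF this that(3)] show ?thesis
        using Gsub by (simp add: sets_measure_of space_measure_of)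
    qed
    then have "{W s -` S \<inter> space M | s S. 0 \<le> s \<and> s \<le> t \<and> S \<in> sets borel} \<subseteq> sigma_sets (space M) G"
      by auto
    then have "sigma_sets (space M) {W s -` S \<inter> space M | s S. 0 \<le> s \<and> s \<le> t \<and> S \<in> sets borel}
        \<subseteq> sigma_sets (space M) G"
      by (rule sigma_sets_mono)
    then show ?thesis using A by (auto simp: sets_past)
  qed
  ultimately have "prob (A \<inter> ?E) = prob A * prob ?E"
    by (rule indep_setD) auto
  also have "prob ?E = prob {\<omega> \<in> space M. Re (W v \<omega>) - Re (W t \<omega>) \<in> C}
              * prob {\<omega> \<in> space M. Im (W v \<omega>) - Im (W t \<omega>) \<in> C'}"
    using prob_cylinder_and_increment[of "{}" t v, OF _ _ t _ _ C] by (simp add: prob_space)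
  finally show ?thesis .
qed

end

text \<open>
  Staying in an open set at a dense set of times is not enough to stay there always, because the
  path may touch the boundary in between. The image of a compact time interval is compact, so it
  lies in one set of an exhaustion by compact sets, and for closed sets a countable dense set of
  times does suffice.
\<close>

lemma continuous_stays_in_open_measurable:
  fixes V :: "real \<Rightarrow> 'w \<Rightarrow> 'b::euclidean_space"
  assumes V: "\<And>s. s \<in> {c..d} \<Longrightarrow> V s \<in> borel_measurable N"
    and cont: "\<And>\<omega>. \<omega> \<in> space N \<Longrightarrow> continuous_on {c..d} (\<lambda>s. V s \<omega>)"
    and G: "open G"
  shows "{\<omega> \<in> space N. \<forall>s\<in>{c..d}. V s \<omega> \<in> G} \<in> sets N"
proof -
  obtain K :: "nat \<Rightarrow> 'b set" where K: "\<And>n. compact (K n)" "\<And>n. K n \<subseteq> G"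
    "\<And>L. compact L \<Longrightarrow> L \<subseteq> G \<Longrightarrow> \<exists>n. \<forall>m\<ge>n. L \<subseteq> K m"
    using open_Union_compact_subsets[OF G] by metis
  obtain Q :: "real set" where Q: "countable Q" "Q \<subseteq> {c..d}" "{c..d} \<subseteq> closure Q"
    using separable[of "{c..d}"] by metis
  have "{\<omega> \<in> space N. \<forall>s\<in>{c..d}. V s \<omega> \<in> G} = {\<omega> \<in> space N. \<exists>n. \<forall>s\<in>Q. V s \<omega> \<in> K n}"
  proof (intro Collect_cong conj_cong refl iffI)
    fix \<omega> assume \<omega>: "\<omega> \<in> space N" "\<forall>s\<in>{c..d}. V s \<omega> \<in> G"
    have "compact ((\<lambda>s. V s \<omega>) ` {c..d})"
      using cont[OF \<omega>(1)] by (intro compact_continuous_image) auto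
    then obtain n where "(\<lambda>s. V s \<omega>) ` {c..d} \<subseteq> K n" using K(3)[of "(\<lambda>s. V s \<omega>) ` {c..d}"] \<omega>(2) by blast
    then show "\<exists>n. \<forall>s\<in>Q. V s \<omega> \<in> K n" using Q(2) by blast
  next
    fix \<omega> assume \<omega>: "\<omega> \<in> space N" "\<exists>n. \<forall>s\<in>Q. V s \<omega> \<in> K n"
    then obtain n where n: "\<forall>s\<in>Q. V s \<omega> \<in> K n" by blast
    have "closure Q = {c..d}" using Q closure_minimal[of Q "{c..d}"] by auto
    then have "(\<lambda>s. V s \<omega>) ` {c..d} \<subseteq> K n"
      using cont[OF \<omega>(1)] n compact_imp_closed[OF K(1)]
      by (metis image_closure_subset image_subsetI)
    then show "\<forall>s\<in>{c..d}. V s \<omega> \<in> G" using K(2) by blast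
  qed
  also have "\<dots> \<in> sets N"
    using V Q(2) borel_closed[OF compact_imp_closed[OF K(1)]]
    by (intro sets.sets_Collect_countable_Ex sets.sets_Collect_countable_All'[OF _ Q(1)]
        measurable_sets_Collect_mem[of _ _ borel]) auto
  finally show ?thesis .
qed

section \<open>Sums of increments over events from the past\<close>

text \<open>
  Each coordinate of the planar motion is a Brownian motion relative to the common history of both
  coordinates, and this is all that the moment computations below use.
\<close>

locale brownian_wrt_filtration = prob_space M
  for M :: "'w measure" and F :: "real \<Rightarrow> 'w measure" and X :: "real \<Rightarrow> 'w \<Rightarrow> real" +
  assumes filtration: "0 \<le> t \<Longrightarrow> subalgebra M (F t)"
    and filtration_mono: "s \<le> t \<Longrightarrow> sets (F s) \<subseteq> sets (F t)"
    and adapted: "0 \<le> s \<Longrightarrow> s \<le> t \<Longrightarrow> X s \<in> borel_measurable (F t)"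
    and increment_indep: "0 \<le> t \<Longrightarrow> t \<le> v \<Longrightarrow> A \<in> sets (F t) \<Longrightarrow> C \<in> sets borel \<Longrightarrow>
      prob (A \<inter> {\<omega> \<in> space M. X v \<omega> - X t \<omega> \<in> C}) = prob A * prob {\<omega> \<in> space M. X v \<omega> - X t \<omega> \<in> C}"
    and increment_normal: "0 \<le> t \<Longrightarrow> t < v \<Longrightarrow>
      distributed M lborel (\<lambda>\<omega>. X v \<omega> - X t \<omega>) (normal_density 0 (sqrt (v - t)))"
    and paths_continuous: "\<omega> \<in> space M \<Longrightarrow> continuous_on {0..} (\<lambda>t. X t \<omega>)"
begin

lemma space_F: "0 \<le> t \<Longrightarrow> space (F t) = space M"
  using filtration unfolding subalgebra_def by blast

lemma events_F: "0 \<le> t \<Longrightarrow> A \<in> sets (F t) \<Longrightarrow> A \<in> events"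
  using filtration unfolding subalgebra_def by blast

lemma measurable_X: "0 \<le> t \<Longrightarrow> X t \<in> borel_measurable M"
  by (rule measurable_from_subalg[OF filtration adapted]) auto

lemma increment_indep_var:
  assumes t: "0 \<le> t" "t \<le> v" and Z: "Z \<in> borel_measurable (F t)"
  shows "indep_var borel Z borel (\<lambda>\<omega>. X v \<omega> - X t \<omega>)"
proof -
  have ZM: "random_variable borel Z" using measurable_from_subalg[OF filtration Z] t by simp
  have DM: "random_variable borel (\<lambda>\<omega>. X v \<omega> - X t \<omega>)"
    using measurable_X t by (intro borel_measurable_diff) auto
  have "indep_set {Z -` S \<inter> space M | S. S \<in> sets borel}
      {(\<lambda>\<omega>. X v \<omega> - X t \<omega>) -` S \<inter> space M | S. S \<in> sets borel}"
  proof (rule indep_setI)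
    fix a b assume "a \<in> {Z -` S \<inter> space M | S. S \<in> sets borel}"
      "b \<in> {(\<lambda>\<omega>. X v \<omega> - X t \<omega>) -` S \<inter> space M | S. S \<in> sets borel}"
    then obtain S C where ab: "a = Z -` S \<inter> space M" "S \<in> sets borel" "C \<in> sets borel"
      "b = {\<omega> \<in> space M. X v \<omega> - X t \<omega> \<in> C}" by auto
    have "a \<in> sets (F t)" using measurable_sets[OF Z ab(2)] t by (simp add: ab space_F)
    from increment_indep[OF t this ab(3)] show "prob (a \<inter> b) = prob a * prob b" by (simp add: ab)
  qed (use ZM DM in \<open>auto intro: measurable_sets\<close>)
  moreover have "Int_stable {Y -` S \<inter> space M | S. S \<in> sets borel}" for Y :: "'w \<Rightarrow> real"
  proof (rule Int_stableI)
    fix a b assume "a \<in> {Y -` S \<inter> space M | S. S \<in> sets borel}" "b \<in> {Y -` S \<inter> space M | S. S \<in> sets borel}"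
    then obtain S S' where "a = Y -` S \<inter> space M" "b = Y -` S' \<inter> space M" "S \<in> sets borel" "S' \<in> sets borel"
      by auto
    then show "a \<inter> b \<in> {Y -` S \<inter> space M | S. S \<in> sets borel}"
      by (intro CollectI exI[of _ "S \<inter> S'"]) auto
  qed
  ultimately show ?thesis
    unfolding indep_var_eq using ZM DM by (intro conjI indep_set_sigma_sets) auto
qed

lemma increment_moments:
  assumes t: "0 \<le> t" "t \<le> v"
  shows "integrable M (\<lambda>\<omega>. X v \<omega> - X t \<omega>)" "expectation (\<lambda>\<omega>. X v \<omega> - X t \<omega>) = 0"
    "integrable M (\<lambda>\<omega>. (X v \<omega> - X t \<omega>)\<^sup>2)" "expectation (\<lambda>\<omega>. (X v \<omega> - X t \<omega>)\<^sup>2) = v - t"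
proof -
  have "integrable M (\<lambda>\<omega>. X v \<omega> - X t \<omega>) \<and> expectation (\<lambda>\<omega>. X v \<omega> - X t \<omega>) = 0 \<and>
    integrable M (\<lambda>\<omega>. (X v \<omega> - X t \<omega>)\<^sup>2) \<and> expectation (\<lambda>\<omega>. (X v \<omega> - X t \<omega>)\<^sup>2) = v - t"
  proof (cases "t = v")
    case False
    then have tv: "t < v" "0 < sqrt (v - t)" using t by auto
    note D = increment_normal[OF t(1) tv(1)]
    have e: "expectation (\<lambda>\<omega>. X v \<omega> - X t \<omega>) = 0"
      using normal_distributed_expectation[OF tv(2) D] .
    have "integrable M (\<lambda>\<omega>. X v \<omega> - X t \<omega>)"
      using distributed_integrable[OF D, of "\<lambda>x. x"] integrable_normal_moment_nz_1[OF tv(2), of 0] by simp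
    moreover have "integrable M (\<lambda>\<omega>. (X v \<omega> - X t \<omega>)\<^sup>2)"
      using distributed_integrable[OF D, of "\<lambda>x. x\<^sup>2"] integrable_normal_moment[OF tv(2), of 0 2] by simp
    moreover have "expectation (\<lambda>\<omega>. (X v \<omega> - X t \<omega>)\<^sup>2) = v - t"
      using normal_distributed_variance[OF tv(2) D] e t by simp
    ultimately show ?thesis using e by blast
  qed auto
  then show "integrable M (\<lambda>\<omega>. X v \<omega> - X t \<omega>)" "expectation (\<lambda>\<omega>. X v \<omega> - X t \<omega>) = 0"
    "integrable M (\<lambda>\<omega>. (X v \<omega> - X t \<omega>)\<^sup>2)" "expectation (\<lambda>\<omega>. (X v \<omega> - X t \<omega>)\<^sup>2) = v - t" by blast+
qed

text \<open>
  A discrete stochastic integral with indicator integrands. Each summand has mean zero and is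
  orthogonal to the sum of the previous ones, because its increment is independent of everything
  known when it starts. Stopping the motion at a grid time is the case of decreasing events.
\<close>

lemma predictable_sum_moments:
  fixes t :: "nat \<Rightarrow> real"
  assumes t: "mono t" "0 \<le> t 0" and E: "\<And>k. k < N \<Longrightarrow> E k \<in> sets (F (t k))"
  defines "Y \<equiv> \<lambda>\<omega>. \<Sum>k<N. indicator (E k) \<omega> * (X (t (Suc k)) \<omega> - X (t k) \<omega>)"
  shows "Y \<in> borel_measurable (F (t N))" "integrable M Y" "expectation Y = 0"
    "integrable M (\<lambda>\<omega>. (Y \<omega>)\<^sup>2)" "expectation (\<lambda>\<omega>. (Y \<omega>)\<^sup>2) = (\<Sum>k<N. prob (E k) * (t (Suc k) - t k))"
proof -
  have t0: "0 \<le> t k" for k by (rule order_trans[OF t(2) monoD[OF t(1) le0]])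
  have ts: "t k \<le> t (Suc k)" for k using t by (simp add: monoD)
  have FF: "measurable (F (t i)) borel \<subseteq> measurable (F (t j)) (borel :: real measure)" if "i \<le> j" for i j
    using that t0 t filtration_mono[of "t i" "t j"] by (intro measurable_mono) (auto simp: space_F monoD)
  have "Y \<in> borel_measurable (F (t N)) \<and> integrable M Y \<and> expectation Y = 0 \<and>
    integrable M (\<lambda>\<omega>. (Y \<omega>)\<^sup>2) \<and> expectation (\<lambda>\<omega>. (Y \<omega>)\<^sup>2) = (\<Sum>k<N. prob (E k) * (t (Suc k) - t k))"
    unfolding Y_def using E
  proof (induction N)
    case 0 then show ?case by simp
  next
    case (Suc n)
    define S where "S \<omega> = (\<Sum>k<n. indicator (E k) \<omega> * (X (t (Suc k)) \<omega> - X (t k) \<omega>))" for \<omega>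
    define I :: "'w \<Rightarrow> real" where "I = indicator (E n)"
    define d where "d \<omega> = X (t (Suc n)) \<omega> - X (t n) \<omega>" for \<omega>
    have IH: "S \<in> borel_measurable (F (t n))" "integrable M S" "expectation S = 0"
      "integrable M (\<lambda>\<omega>. (S \<omega>)\<^sup>2)" "expectation (\<lambda>\<omega>. (S \<omega>)\<^sup>2) = (\<Sum>k<n. prob (E k) * (t (Suc k) - t k))"
      using Suc unfolding S_def by auto
    have En: "E n \<in> sets (F (t n))" "E n \<in> events" using Suc.prems events_F t0 by auto
    have I: "I \<in> borel_measurable (F (t n))" "I \<in> borel_measurable M" unfolding I_def using En by auto
    have SM: "S \<in> borel_measurable M" using IH(2) by auto
    note dm = increment_moments[OF t0 ts, of n, folded d_def]
    have II: "integrable M I" "expectation I = prob (E n)"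
      using En sets.sets_into_space[OF En(2)] by (auto simp: I_def Int_absorb2 less_top[symmetric])
    have I2: "I \<omega> * I \<omega> = I \<omega>" for \<omega> by (simp add: I_def indicator_def)
    have SI: "(\<lambda>\<omega>. S \<omega> * I \<omega>) \<in> borel_measurable (F (t n))" using IH(1) I(1) by measurable
    have SIi: "integrable M (\<lambda>\<omega>. S \<omega> * I \<omega>)"
      by (rule Bochner_Integration.integrable_bound[OF IH(2)]) (use borel_measurable_times[OF SM I(2)] in \<open>auto simp: I_def abs_mult split: split_indicator\<close>)
    note i1 = increment_indep_var[OF t0 ts I(1), folded d_def]
    note i2 = increment_indep_var[OF t0 ts SI, folded d_def]
    have i3: "indep_var borel I borel (\<lambda>\<omega>. (d \<omega>)\<^sup>2)"
      using indep_var_compose[OF i1, of "\<lambda>x. x" borel "\<lambda>x. x\<^sup>2" borel] by (simp add: comp_def)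
    have Id: "integrable M (\<lambda>\<omega>. I \<omega> * d \<omega>)" "expectation (\<lambda>\<omega>. I \<omega> * d \<omega>) = 0"
      using indep_var_integrable[OF i1 II(1) dm(1)] indep_var_lebesgue_integral[OF i1 II(1) dm(1)] dm by auto
    have SId: "integrable M (\<lambda>\<omega>. S \<omega> * I \<omega> * d \<omega>)" "expectation (\<lambda>\<omega>. S \<omega> * I \<omega> * d \<omega>) = 0"
      using indep_var_integrable[OF i2 SIi dm(1)] indep_var_lebesgue_integral[OF i2 SIi dm(1)] dm by auto
    have Id2: "integrable M (\<lambda>\<omega>. I \<omega> * (d \<omega>)\<^sup>2)"
      "expectation (\<lambda>\<omega>. I \<omega> * (d \<omega>)\<^sup>2) = prob (E n) * (t (Suc n) - t n)"
      using indep_var_integrable[OF i3 II(1) dm(3)] indep_var_lebesgue_integral[OF i3 II(1) dm(3)] dm II by auto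
    have sq: "(S \<omega> + I \<omega> * d \<omega>)\<^sup>2 = (S \<omega>)\<^sup>2 + 2 * (S \<omega> * I \<omega> * d \<omega>) + I \<omega> * (d \<omega>)\<^sup>2" for \<omega>
      using I2[of \<omega>] by (auto simp: power2_eq_square algebra_simps)
    have m: "(\<lambda>\<omega>. S \<omega> + I \<omega> * d \<omega>) \<in> borel_measurable (F (t (Suc n)))"
      unfolding d_def using FF[of n "Suc n"] IH(1) I(1) adapted t0 ts
      by (intro borel_measurable_add borel_measurable_times borel_measurable_diff) auto
    have e: "(\<Sum>k<Suc n. indicator (E k) \<omega> * (X (t (Suc k)) \<omega> - X (t k) \<omega>)) = S \<omega> + I \<omega> * d \<omega>" for \<omega>
      by (simp add: S_def I_def d_def)
    show ?case unfolding e sq using m IH Id SId Id2 by simp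
  qed
  then show "Y \<in> borel_measurable (F (t N))" "integrable M Y" "expectation Y = 0"
    "integrable M (\<lambda>\<omega>. (Y \<omega>)\<^sup>2)" "expectation (\<lambda>\<omega>. (Y \<omega>)\<^sup>2) = (\<Sum>k<N. prob (E k) * (t (Suc k) - t k))"
    by blast+
qed

text \<open>
  Kolmogorov's inequality, conditioned on an event \<open>A\<close> of the past: stop the motion at the first
  grid time at which it is \<open>\<epsilon>\<close> away from its position at the start of the grid, and apply
  Chebyshev's inequality to the stopped increment. The factor \<open>prob A\<close> on the right is what later
  makes the choice of a short time span independent of \<open>A\<close>.
\<close>

lemma maximal_inequality_grid:
  fixes t :: "nat \<Rightarrow> real"
  assumes t: "mono t" "0 \<le> t 0" and A: "A \<in> sets (F (t 0))" and \<epsilon>: "0 < \<epsilon>"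
  shows "prob {\<omega> \<in> A. \<exists>k\<le>N. \<epsilon> \<le> \<bar>X (t k) \<omega> - X (t 0) \<omega>\<bar>} \<le> prob A * (t N - t 0) / \<epsilon>\<^sup>2"
proof -
  have t0: "0 \<le> t k" for k by (rule order_trans[OF t(2) monoD[OF t(1) le0]])
  have tm: "i \<le> j \<Longrightarrow> t i \<le> t j" for i j using t by (simp add: monoD)
  define E where "E k = A \<inter> {\<omega> \<in> space (F (t k)). \<forall>j\<in>{..k}. X (t j) \<omega> - X (t 0) \<omega> \<in> {-\<epsilon><..<\<epsilon>}}" for k
  have EF: "E k \<in> sets (F (t k))" for k
    unfolding E_def using A filtration_mono[OF tm[of 0 k]] adapted t0 tm
    by (intro sets.Int sets.sets_Collect_finite_All measurable_sets_Collect_mem[of _ _ borel] borel_measurable_diff) auto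
  have AM: "A \<in> events" using events_F[OF t(2) A] .
  define Y where "Y \<omega> = (\<Sum>k<N. indicator (E k) \<omega> * (X (t (Suc k)) \<omega> - X (t k) \<omega>))" for \<omega>
  note Y = predictable_sum_moments[OF t EF, of N, folded Y_def]
  have sub: "{\<omega> \<in> A. \<exists>k\<le>N. \<epsilon> \<le> \<bar>X (t k) \<omega> - X (t 0) \<omega>\<bar>} \<subseteq> {\<omega> \<in> space M. \<epsilon>\<^sup>2 \<le> (Y \<omega>)\<^sup>2}"
  proof safe
    fix \<omega> k assume \<omega>: "\<omega> \<in> A" and k: "k \<le> N" "\<epsilon> \<le> \<bar>X (t k) \<omega> - X (t 0) \<omega>\<bar>"
    define m where "m = (LEAST k. \<epsilon> \<le> \<bar>X (t k) \<omega> - X (t 0) \<omega>\<bar>)"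
    have m: "\<epsilon> \<le> \<bar>X (t m) \<omega> - X (t 0) \<omega>\<bar>" "m \<le> N"
      unfolding m_def using LeastI[of "\<lambda>k. \<epsilon> \<le> \<bar>X (t k) \<omega> - X (t 0) \<omega>\<bar>" k]
        Least_le[of "\<lambda>k. \<epsilon> \<le> \<bar>X (t k) \<omega> - X (t 0) \<omega>\<bar>" k] k
      by linarith+
    show sp: "\<omega> \<in> space M" using \<omega> AM sets.sets_into_space by auto
    have "\<omega> \<in> E j \<longleftrightarrow> j < m" for j
    proof
      assume "\<omega> \<in> E j"
      then have "X (t i) \<omega> - X (t 0) \<omega> \<in> {-\<epsilon><..<\<epsilon>}" if "i \<le> j" for i
        using that unfolding E_def by blast
      then have "\<bar>X (t i) \<omega> - X (t 0) \<omega>\<bar> < \<epsilon>" if "i \<le> j" for i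
        using that by (force simp: abs_less_iff)
      then show "j < m" using m(1) by (meson not_le)
    next
      assume "j < m"
      then have "\<bar>X (t i) \<omega> - X (t 0) \<omega>\<bar> < \<epsilon>" if "i \<le> j" for i
        using not_less_Least[of i "\<lambda>k. \<epsilon> \<le> \<bar>X (t k) \<omega> - X (t 0) \<omega>\<bar>"] that by (auto simp: m_def)
      then have "X (t i) \<omega> - X (t 0) \<omega> \<in> {-\<epsilon><..<\<epsilon>}" if "i \<le> j" for i
        using that by (force simp: abs_less_iff)
      then show "\<omega> \<in> E j" using \<omega> sp t0 by (simp add: E_def space_F)
    qed
    then have "Y \<omega> = (\<Sum>k<N. if k \<in> {..<m} then X (t (Suc k)) \<omega> - X (t k) \<omega> else 0)"
      unfolding Y_def by (intro sum.cong) auto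
    also have "\<dots> = (\<Sum>k\<in>{..<N} \<inter> {..<m}. X (t (Suc k)) \<omega> - X (t k) \<omega>)"
      by (simp only: sum.inter_restrict[OF finite_lessThan])
    also have "{..<N} \<inter> {..<m} = {..<m}" using m by auto
    also have "(\<Sum>k<m. X (t (Suc k)) \<omega> - X (t k) \<omega>) = X (t m) \<omega> - X (t 0) \<omega>"
      by (rule sum_lessThan_telescope)
    finally show "\<epsilon>\<^sup>2 \<le> (Y \<omega>)\<^sup>2" using m(1) \<epsilon> by (metis abs_le_square_iff abs_of_pos)
  qed
  have YM: "Y \<in> borel_measurable M" using Y(2) by auto
  have "prob {\<omega> \<in> A. \<exists>k\<le>N. \<epsilon> \<le> \<bar>X (t k) \<omega> - X (t 0) \<omega>\<bar>} \<le> prob {\<omega> \<in> space M. \<epsilon>\<^sup>2 \<le> (Y \<omega>)\<^sup>2}"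
    using sub YM by (intro finite_measure_mono) measurable
  also have "\<dots> \<le> expectation (\<lambda>\<omega>. (Y \<omega>)\<^sup>2) / \<epsilon>\<^sup>2"
    using integral_Markov_inequality_measure[OF Y(4), of "{}" "\<epsilon>\<^sup>2"] \<epsilon> by simp
  also have "expectation (\<lambda>\<omega>. (Y \<omega>)\<^sup>2) \<le> (\<Sum>k<N. prob A * (t (Suc k) - t k))"
    unfolding Y(5) using AM t by (intro sum_mono mult_right_mono finite_measure_mono) (auto simp: E_def monoD)
  also have "\<dots> = prob A * (t N - t 0)"
    by (simp add: sum_distrib_left[symmetric] sum_lessThan_telescope)
  finally show ?thesis using \<epsilon> by (simp add: divide_right_mono)
qed

text \<open>
  An excursion to distance \<open>\<epsilon>\<close> at some real time is seen, by continuity, as an excursion to distance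
  \<open>\<delta>\<close> on every sufficiently fine grid.
\<close>

lemma maximal_inequality:
  assumes T: "0 \<le> T" "0 \<le> h" and A: "A \<in> sets (F T)" and \<epsilon>: "0 < \<delta>" "\<delta> < \<epsilon>"
  shows "prob {\<omega> \<in> A. \<exists>s\<in>{T..T + h}. \<epsilon> \<le> \<bar>X s \<omega> - X T \<omega>\<bar>} \<le> prob A * h / \<delta>\<^sup>2"
proof -
  define t where "t n k = T + real k * (h / Suc n)" for n k :: nat
  define B where "B n = {\<omega> \<in> A. \<exists>k\<in>{..Suc n}. \<delta> \<le> \<bar>X (t n k) \<omega> - X T \<omega>\<bar>}" for n
  have t: "mono (t n)" "t n 0 = T" "t n (Suc n) = T + h" "0 \<le> t n k" for n k
    using T by (auto simp: t_def mono_def mult_right_mono divide_right_mono)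
  have AM: "A \<in> events" using events_F[OF T(1) A] .
  have BM: "B n \<in> events" for n
  proof -
    have "B n = A \<inter> {\<omega> \<in> space M. \<exists>k\<in>{..Suc n}. \<delta> \<le> \<bar>X (t n k) \<omega> - X T \<omega>\<bar>}"
      using sets.sets_into_space[OF AM] by (auto simp: B_def)
    also have "\<dots> \<in> events"
      using AM measurable_X[OF T(1)] measurable_X[OF t(4)]
      by (intro sets.Int sets.sets_Collect_finite_Ex borel_measurable_le borel_measurable_abs
            borel_measurable_diff borel_measurable_const) auto
    finally show ?thesis .
  qed
  have pB: "prob (B n) \<le> prob A * h / \<delta>\<^sup>2" for n
    using maximal_inequality_grid[OF t(1), of n A \<delta> "Suc n"] t[of n] T A \<epsilon> by (simp add: B_def Bex_def)
  define H where "H N = (\<Inter>n\<in>{N..}. B n)" for N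
  have HM: "H N \<in> events" for N unfolding H_def using BM by (intro sets.countable_INT') auto
  have "incseq H" unfolding H_def by (intro monoI INF_superset_mono) auto
  then have lim: "(\<lambda>N. prob (H N)) \<longlonglongrightarrow> prob (\<Union>N. H N)"
    using HM by (intro finite_Lim_measure_incseq) auto
  have "prob (H N) \<le> prob A * h / \<delta>\<^sup>2" for N
    using finite_measure_mono[of "H N" "B N"] BM pB[of N] by (force simp: H_def)
  then have "prob (\<Union>N. H N) \<le> prob A * h / \<delta>\<^sup>2" using LIMSEQ_le_const2[OF lim] by blast
  moreover have "{\<omega> \<in> A. \<exists>s\<in>{T..T + h}. \<epsilon> \<le> \<bar>X s \<omega> - X T \<omega>\<bar>} \<subseteq> (\<Union>N. H N)"
  proof safe
    fix \<omega> s assume \<omega>: "\<omega> \<in> A" and s: "s \<in> {T..T + h}" "\<epsilon> \<le> \<bar>X s \<omega> - X T \<omega>\<bar>"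
    have \<omega>': "\<omega> \<in> space M" using \<omega> AM sets.sets_into_space by auto
    \<comment> \<open>The last grid point before \<open>s\<close>; for \<open>h = 0\<close> the division by zero gives the index 0.\<close>
    define k where "k n = nat \<lfloor>(s - T) * Suc n / h\<rfloor>" for n :: nat
    have k: "k n \<le> Suc n" "t n (k n) \<le> s" "s \<le> t n (k n) + h / Suc n" for n
    proof -
      have "k n \<le> Suc n \<and> t n (k n) \<le> s \<and> s \<le> t n (k n) + h / Suc n"
      proof (cases "h = 0")
        case True then show ?thesis using s by (simp add: k_def t_def)
      next
        case False
        then have h: "0 < h" using T by simp
        define q where "q = (s - T) * Suc n / h"
        have "(s - T) / h \<le> 1" "0 \<le> (s - T) / h" using s h by auto
        then have q: "0 \<le> q" "q \<le> Suc n"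
          using mult_right_mono[of "(s - T) / h" 1 "real (Suc n)"] mult_nonneg_nonneg[of "(s - T) / h" "real (Suc n)"]
          by (auto simp: q_def)
        have kq: "real (k n) \<le> q" "q \<le> real (k n) + 1"
          using q(1) unfolding k_def q_def[symmetric] by linarith+
        have "k n \<le> Suc n" using kq q by linarith
        moreover have "s = T + q * (h / Suc n)" using h by (simp add: q_def)
        moreover have "real (k n) * (h / Suc n) \<le> q * (h / Suc n)" "q * (h / Suc n) \<le> (real (k n) + 1) * (h / Suc n)"
          using kq h by (auto intro!: divide_right_mono mult_right_mono)
        ultimately show ?thesis unfolding t_def by (simp add: algebra_simps add_divide_distrib)
      qed
      then show "k n \<le> Suc n" "t n (k n) \<le> s" "s \<le> t n (k n) + h / Suc n" by blast+
    qed
    have "(\<lambda>n. h / Suc n) \<longlonglongrightarrow> 0"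
      using tendsto_mult_right_zero[OF LIMSEQ_inverse_real_of_nat, of h] by (simp add: divide_inverse)
    then have "(\<lambda>n. s - h / Suc n) \<longlonglongrightarrow> s" using tendsto_diff[OF tendsto_const, of _ 0 sequentially s] by simp
    then have conv: "(\<lambda>n. t n (k n)) \<longlonglongrightarrow> s"
      by (rule tendsto_sandwich[rotated 2, OF _ tendsto_const]) (use k in \<open>auto intro!: always_eventually simp: algebra_simps\<close>)
    have "(\<lambda>n. X (t n (k n)) \<omega>) \<longlonglongrightarrow> X s \<omega>"
      using continuous_on_tendsto_compose[OF paths_continuous[OF \<omega>'] conv] s T t(4) by (simp add: always_eventually)
    then have "(\<lambda>n. \<bar>X (t n (k n)) \<omega> - X T \<omega>\<bar>) \<longlonglongrightarrow> \<bar>X s \<omega> - X T \<omega>\<bar>"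
      by (intro tendsto_rabs tendsto_diff tendsto_const)
    then have "eventually (\<lambda>n. \<delta> < \<bar>X (t n (k n)) \<omega> - X T \<omega>\<bar>) sequentially"
      using less_le_trans[OF \<epsilon>(2) s(2)] by (rule order_tendstoD(1))
    then obtain N where N: "\<And>n. n \<ge> N \<Longrightarrow> \<delta> < \<bar>X (t n (k n)) \<omega> - X T \<omega>\<bar>"
      unfolding eventually_sequentially by blast
    have "\<omega> \<in> B n" if "n \<ge> N" for n
      using N[OF that] k(1)[of n] \<omega> by (auto simp: B_def intro!: bexI[of _ "k n"])
    then show "\<omega> \<in> (\<Union>N. H N)" by (auto simp: H_def)
  qed
  ultimately show ?thesis
    using finite_measure_mono[of _ "\<Union>N. H N"] HM by (meson order_trans sets.countable_UN image_subsetI subset_UNIV)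
qed

end

section \<open>Reachable points\<close>

lemma std_normal_interval_pos:
  assumes "l < r"
  shows "0 < measure (density lborel std_normal_density) {l<..<r}"
proof -
  interpret N: prob_space "density lborel std_normal_density"
    by (rule prob_space_normal_density) simp
  have "{l<..<r} \<notin> null_sets (density lborel std_normal_density)"
  proof
    assume "{l<..<r} \<in> null_sets (density lborel std_normal_density)"
    then have "AE x in lborel. x \<in> {l<..<r} \<longrightarrow> ennreal (std_normal_density x) = 0"
      by (subst (asm) null_sets_density_iff) auto
    moreover have "\<not> std_normal_density x \<le> 0" for x using normal_density_pos[of 1 0 x] by simp
    ultimately have "AE x in lborel. x \<notin> {l<..<r}"
      by (auto elim!: eventually_mono simp: ennreal_eq_0_iff)
    then have "{l<..<r} \<in> null_sets lborel" by (subst (asm) AE_iff_null_sets[symmetric]) auto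
    then show False using assms by (auto simp: null_sets_def)
  qed
  then show ?thesis
    by (auto simp: null_sets_def N.emeasure_eq_measure zero_less_measure_iff)
qed

lemma (in brownian_wrt_filtration) prob_scaled_increment:
  assumes T: "0 \<le> T" "0 < h"
  shows "prob {\<omega> \<in> space M. X (T + h) \<omega> - X T \<omega> \<in> {sqrt h * l<..<sqrt h * r}}
    = measure (density lborel std_normal_density) {l<..<r}"
proof -
  have h: "0 < sqrt h" using T by simp
  have "distributed M lborel (\<lambda>\<omega>. X (T + h) \<omega> - X T \<omega>) (normal_density 0 (sqrt h))"
    using increment_normal[of T "T + h"] T by simp
  then have D: "distributed M lborel (\<lambda>\<omega>. (X (T + h) \<omega> - X T \<omega>) / sqrt h) std_normal_density"
    using normal_standard_normal_convert[OF h, of _ 0] by simp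
  have "measure (density lborel std_normal_density) {l<..<r} =
      measure (distr M lborel (\<lambda>\<omega>. (X (T + h) \<omega> - X T \<omega>) / sqrt h)) {l<..<r}"
    using distributed_distr_eq_density[OF D] by simp
  also have "\<dots> = prob ((\<lambda>\<omega>. (X (T + h) \<omega> - X T \<omega>) / sqrt h) -` {l<..<r} \<inter> space M)"
    using distributed_measurable[OF D] by (intro measure_distr) auto
  also have "(\<lambda>\<omega>. (X (T + h) \<omega> - X T \<omega>) / sqrt h) -` {l<..<r} \<inter> space M
      = {\<omega> \<in> space M. X (T + h) \<omega> - X T \<omega> \<in> {sqrt h * l<..<sqrt h * r}}"
    using h by (auto simp: field_simps)
  finally show ?thesis by simp
qed

context complex_brownian_motion
begin

lemma adapted_Re_Im:
  assumes "0 \<le> s" "s \<le> t"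
  shows "(\<lambda>\<omega>. Re (W s \<omega>)) \<in> borel_measurable (past M W t)" "(\<lambda>\<omega>. Im (W s \<omega>)) \<in> borel_measurable (past M W t)"
  using measurable_past[OF assms, of W M] by (auto simp: borel_measurable_complex_iff)

lemma subalgebra_past: "0 \<le> t \<Longrightarrow> subalgebra M (past M W t)"
  using past_events by (auto simp: subalgebra_def)

sublocale re_past: brownian_wrt_filtration M "past M W" "\<lambda>t \<omega>. Re (W t \<omega>)"
proof
  fix t v :: real and A and C :: "real set" assume *: "0 \<le> t" "t \<le> v" "A \<in> sets (past M W t)" "C \<in> sets borel"
  show "prob (A \<inter> {\<omega> \<in> space M. Re (W v \<omega>) - Re (W t \<omega>) \<in> C}) =
      prob A * prob {\<omega> \<in> space M. Re (W v \<omega>) - Re (W t \<omega>) \<in> C}"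
    using increment_indep_past[OF *(3,1,2,4), of UNIV] by (simp add: prob_space)
qed (use adapted_Re_Im subalgebra_past re.normal_increments re.continuous_paths in \<open>auto intro: past_mono[THEN subsetD]\<close>)

sublocale im_past: brownian_wrt_filtration M "past M W" "\<lambda>t \<omega>. Im (W t \<omega>)"
proof
  fix t v :: real and A and C :: "real set" assume *: "0 \<le> t" "t \<le> v" "A \<in> sets (past M W t)" "C \<in> sets borel"
  show "prob (A \<inter> {\<omega> \<in> space M. Im (W v \<omega>) - Im (W t \<omega>) \<in> C}) =
      prob A * prob {\<omega> \<in> space M. Im (W v \<omega>) - Im (W t \<omega>) \<in> C}"
    using increment_indep_past[OF *(3,1,2), of UNIV C] *(4) by (simp add: prob_space)
qed (use adapted_Re_Im subalgebra_past im.normal_increments im.continuous_paths in \<open>auto intro: past_mono[THEN subsetD]\<close>)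

lemma stays_in_past:
  assumes "open D"
  shows "{\<omega> \<in> space M. \<forall>s\<in>{0..T}. W s \<omega> \<in> D} \<in> sets (past M W T)"
proof -
  have "{\<omega> \<in> space (past M W T). \<forall>s\<in>{0..T}. W s \<omega> \<in> D} \<in> sets (past M W T)"
    by (rule continuous_stays_in_open_measurable)
       (use assms measurable_past continuous_on_subset[OF continuous_W] in auto)
  then show ?thesis by simp
qed

text \<open>
  By scaling, the increment over time \<open>h\<close>, divided by \<open>sqrt h\<close>, falls near the unit vector \<open>u\<close>
  with a probability \<open>p > 0\<close> that does not depend on \<open>h\<close>, whereas by the maximal inequality the
  probability of leaving the \<open>\<epsilon>\<close>-disc in the meantime tends to 0 with \<open>h\<close>. Both bounds are
  proportional to \<open>prob A\<close>, so the threshold \<open>h0\<close> can be chosen before \<open>T\<close> and \<open>A\<close>.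
\<close>

lemma exists_short_step:
  assumes u: "norm u = 1" and \<epsilon>: "0 < \<epsilon>"
  shows "\<exists>h0>0. \<forall>h T A. 0 < h \<longrightarrow> h \<le> h0 \<longrightarrow> 0 \<le> T \<longrightarrow> A \<in> sets (past M W T) \<longrightarrow> 0 < prob A \<longrightarrow>
    (\<exists>E\<in>events. 0 < prob E \<and> E \<subseteq> {\<omega> \<in> A. (\<forall>s\<in>{T..T+h}. norm (W s \<omega> - W T \<omega>) < \<epsilon>) \<and>
       norm (W (T + h) \<omega> - W T \<omega> - sqrt h *\<^sub>R u) \<le> sqrt h / 2})"
proof -
  define I where "I c = {c - 1/4<..<c + 1/4}" for c :: real
  define p where "p = measure (density lborel std_normal_density) (I (Re u)) *
    measure (density lborel std_normal_density) (I (Im u))"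
  have p: "0 < p" unfolding p_def I_def by (intro mult_pos_pos std_normal_interval_pos) auto
  \<comment> \<open>Each coordinate then spoils at most a quarter of the probability \<open>prob A * p\<close>.\<close>
  define h0 where "h0 = p * \<epsilon>\<^sup>2 / 64"
  have h0: "0 < h0" using p \<epsilon> by (simp add: h0_def)
  have "\<exists>E\<in>events. 0 < prob E \<and> E \<subseteq> {\<omega> \<in> A. (\<forall>s\<in>{T..T+h}. norm (W s \<omega> - W T \<omega>) < \<epsilon>) \<and>
       norm (W (T + h) \<omega> - W T \<omega> - sqrt h *\<^sub>R u) \<le> sqrt h / 2}"
    if h: "0 < h" "h \<le> h0" and T: "0 \<le> T" and A: "A \<in> sets (past M W T)" "0 < prob A" for h T A
  proof -
    have AM: "A \<in> events" using past_events[OF T] A by blast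
    have As: "A \<subseteq> space M" using AM by (rule sets.sets_into_space)
    define J where "J c = {sqrt h * (c - 1/4)<..<sqrt h * (c + 1/4)}" for c :: real
    define Q where "Q = {\<omega> \<in> space M. Re (W (T + h) \<omega>) - Re (W T \<omega>) \<in> J (Re u) \<and>
       Im (W (T + h) \<omega>) - Im (W T \<omega>) \<in> J (Im u)}"
    have QM: "Q \<in> events"
      unfolding Q_def J_def using re_past.measurable_X im_past.measurable_X h T
      by (intro sets.sets_Collect_conj measurable_sets_Collect_mem[of _ _ borel] borel_measurable_diff) auto
    have pAQ: "prob (A \<inter> Q) = prob A * p"
      using increment_indep_past[OF A(1) T, of "T + h" "J (Re u)" "J (Im u)"] h
      unfolding Q_def p_def J_def I_def re_past.prob_scaled_increment[OF T h(1)]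
        im_past.prob_scaled_increment[OF T h(1)]
      by simp
    define BR where "BR = {\<omega> \<in> A. \<exists>s\<in>{T..T+h}. \<epsilon> / 2 \<le> \<bar>Re (W s \<omega>) - Re (W T \<omega>)\<bar>}"
    define BI where "BI = {\<omega> \<in> A. \<exists>s\<in>{T..T+h}. \<epsilon> / 2 \<le> \<bar>Im (W s \<omega>) - Im (W T \<omega>)\<bar>}"
    have cW: "continuous_on {T..T+h} (\<lambda>s. W s \<omega>)" if "\<omega> \<in> space M" for \<omega>
      using continuous_on_subset[OF continuous_W[OF that]] T by auto
    have out: "x \<in> {-c<..<c} \<longleftrightarrow> \<not> c \<le> \<bar>x\<bar>" for x c :: real by auto
    have "BR = A - {\<omega> \<in> space M. \<forall>s\<in>{T..T+h}. Re (W s \<omega>) - Re (W T \<omega>) \<in> {-(\<epsilon>/2)<..<\<epsilon>/2}}"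
      unfolding BR_def out using As by blast
    also have "\<dots> \<in> events"
      by (intro sets.Diff AM continuous_stays_in_open_measurable)
        (use T cW in \<open>auto intro!: borel_measurable_diff re_past.measurable_X continuous_intros\<close>)
    finally have BR: "BR \<in> events" .
    have "BI = A - {\<omega> \<in> space M. \<forall>s\<in>{T..T+h}. Im (W s \<omega>) - Im (W T \<omega>) \<in> {-(\<epsilon>/2)<..<\<epsilon>/2}}"
      unfolding BI_def out using As by blast
    also have "\<dots> \<in> events"
      by (intro sets.Diff AM continuous_stays_in_open_measurable)
        (use T cW in \<open>auto intro!: borel_measurable_diff im_past.measurable_X continuous_intros\<close>)
    finally have BI: "BI \<in> events" .
    have "h / (\<epsilon> / 4)\<^sup>2 \<le> p / 4"
      using h \<epsilon> by (simp add: h0_def field_simps)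
    then have small: "prob A * h / (\<epsilon> / 4)\<^sup>2 \<le> prob A * p / 4"
      using A(2) by (metis mult_le_cancel_left_pos times_divide_eq_right)
    have pb: "prob BR \<le> prob A * p / 4" "prob BI \<le> prob A * p / 4"
      unfolding BR_def BI_def using \<epsilon> h
      by (intro order_trans[OF re_past.maximal_inequality small] order_trans[OF im_past.maximal_inequality small] T A; simp)+
    define E where "E = (A \<inter> Q) - (BR \<union> BI)"
    have "prob E \<ge> prob A * p - prob (BR \<union> BI)"
    proof -
      have "prob (A \<inter> Q) \<le> prob (E \<union> (BR \<union> BI))"
        using AM QM BR BI by (intro finite_measure_mono) (auto simp: E_def)
      also have "\<dots> \<le> prob E + prob (BR \<union> BI)"
        using AM QM BR BI by (intro measure_Un_le) (auto simp: E_def)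
      finally show ?thesis using pAQ by simp
    qed
    moreover have "prob (BR \<union> BI) \<le> prob BR + prob BI" using BR BI by (rule measure_Un_le)
    ultimately have "prob E \<ge> prob A * p / 2" using pb by simp
    then have "0 < prob E" using A(2) p by (smt (verit) divide_pos_pos mult_pos_pos)
    moreover have "E \<in> events" using AM QM BR BI by (auto simp: E_def)
    moreover have "E \<subseteq> {\<omega> \<in> A. (\<forall>s\<in>{T..T+h}. norm (W s \<omega> - W T \<omega>) < \<epsilon>) \<and>
       norm (W (T + h) \<omega> - W T \<omega> - sqrt h *\<^sub>R u) \<le> sqrt h / 2}"
    proof safe
      fix \<omega> assume \<omega>: "\<omega> \<in> E"
      then show "\<omega> \<in> A" by (simp add: E_def)
      fix s assume s: "s \<in> {T..T+h}"
      have "\<bar>Re (W s \<omega>) - Re (W T \<omega>)\<bar> < \<epsilon>/2" "\<bar>Im (W s \<omega>) - Im (W T \<omega>)\<bar> < \<epsilon>/2"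
        using \<omega> s by (auto simp: E_def BR_def BI_def not_le)
      then show "norm (W s \<omega> - W T \<omega>) < \<epsilon>"
        using cmod_le[of "W s \<omega> - W T \<omega>"] by simp
    next
      fix \<omega> assume \<omega>: "\<omega> \<in> E"
      have J_abs: "\<bar>x - sqrt h * c\<bar> < sqrt h / 4" if "x \<in> J c" for x c
      proof -
        have "sqrt h * c - sqrt h / 4 < x" "x < sqrt h * c + sqrt h / 4"
          using that by (auto simp: J_def right_diff_distrib distrib_left)
        then show ?thesis by linarith
      qed
      have "\<bar>Re (W (T + h) \<omega>) - Re (W T \<omega>) - sqrt h * Re u\<bar> < sqrt h / 4"
        "\<bar>Im (W (T + h) \<omega>) - Im (W T \<omega>) - sqrt h * Im u\<bar> < sqrt h / 4"
        using \<omega> unfolding E_def Q_def by (blast intro: J_abs)+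
      then show "norm (W (T + h) \<omega> - W T \<omega> - sqrt h *\<^sub>R u) \<le> sqrt h / 2"
        using cmod_le[of "W (T + h) \<omega> - W T \<omega> - sqrt h *\<^sub>R u"] by simp
    qed
    ultimately show ?thesis by blast
  qed
  then show ?thesis using h0 by blast
qed

text \<open>
  The support of the motion killed on leaving \<open>D\<close>, taken over all times together.
\<close>

definition reachable :: "complex set \<Rightarrow> complex \<Rightarrow> bool" where
  "reachable D z \<longleftrightarrow>
    (\<forall>r>0. \<exists>T\<ge>0. 0 < prob {\<omega> \<in> space M. (\<forall>s\<in>{0..T}. W s \<omega> \<in> D) \<and> W T \<omega> \<in> ball z r})"

lemma staying_hit_past:
  assumes "open D" "0 \<le> T" "S \<in> sets borel"
  shows "{\<omega> \<in> space M. (\<forall>s\<in>{0..T}. W s \<omega> \<in> D) \<and> W T \<omega> \<in> S} \<in> sets (past M W T)"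
proof -
  have "{\<omega> \<in> space (past M W T). W T \<omega> \<in> S} \<in> sets (past M W T)"
    using assms measurable_past by (intro measurable_sets_Collect_mem) auto
  then have "{\<omega> \<in> space M. \<forall>s\<in>{0..T}. W s \<omega> \<in> D} \<inter> {\<omega> \<in> space M. W T \<omega> \<in> S} \<in> sets (past M W T)"
    using stays_in_past[OF assms(1)] by auto
  then show ?thesis by (simp add: Int_def conj_ac)
qed

lemma staying_hit_event:
  assumes "open D" "0 \<le> T" "S \<in> sets borel"
  shows "{\<omega> \<in> space M. (\<forall>s\<in>{0..T}. W s \<omega> \<in> D) \<and> W T \<omega> \<in> S} \<in> events"
  using staying_hit_past[OF assms] past_events[OF assms(2)] by blast

lemma closed_reachable:
  assumes D: "open D"
  shows "closed {z. reachable D z}"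
  unfolding closed_def open_contains_ball
proof
  fix z assume "z \<in> - {z. reachable D z}"
  then obtain r where r: "0 < r"
    "\<And>T. 0 \<le> T \<Longrightarrow> prob {\<omega> \<in> space M. (\<forall>s\<in>{0..T}. W s \<omega> \<in> D) \<and> W T \<omega> \<in> ball z r} = 0"
    unfolding reachable_def zero_less_measure_iff by auto
  have "\<not> reachable D y" if y: "y \<in> ball z (r/2)" for y
  proof
    assume "reachable D y"
    then obtain T where T: "0 \<le> T" "0 < prob {\<omega> \<in> space M. (\<forall>s\<in>{0..T}. W s \<omega> \<in> D) \<and> W T \<omega> \<in> ball y (r/2)}"
      using half_gt_zero[OF r(1)] unfolding reachable_def by blast
    have "ball y (r/2) \<subseteq> ball z r"
    proof
      fix x assume "x \<in> ball y (r/2)"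
      then show "x \<in> ball z r" using y dist_triangle[of z x y] by simp
    qed
    then have "prob {\<omega> \<in> space M. (\<forall>s\<in>{0..T}. W s \<omega> \<in> D) \<and> W T \<omega> \<in> ball y (r/2)}
       \<le> prob {\<omega> \<in> space M. (\<forall>s\<in>{0..T}. W s \<omega> \<in> D) \<and> W T \<omega> \<in> ball z r}"
      using staying_hit_event[OF D T(1), of "ball z r"] by (intro finite_measure_mono) auto
    then show False using T r(2)[OF T(1)] by simp
  qed
  then show "\<exists>e>0. ball z e \<subseteq> - {z. reachable D z}" using r(1) by (intro exI[of _ "r/2"]) auto
qed

text \<open>
  A set of positive measure contains a point of the support: otherwise finitely many null discs
  would cover it.
\<close>

lemma ex_reachable_in_compact:
  assumes D: "open D" and K: "compact K" and T: "0 \<le> T"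
    and pos: "0 < prob {\<omega> \<in> space M. (\<forall>s\<in>{0..T}. W s \<omega> \<in> D) \<and> W T \<omega> \<in> K}"
  shows "\<exists>y\<in>K. reachable D y"
proof (rule ccontr)
  assume none: "\<not> (\<exists>y\<in>K. reachable D y)"
  define E where "E S = {\<omega> \<in> space M. (\<forall>s\<in>{0..T}. W s \<omega> \<in> D) \<and> W T \<omega> \<in> S}" for S
  have "\<exists>r>0. prob (E (ball y r)) = 0" if "y \<in> K" for y
    using none that T unfolding reachable_def E_def zero_less_measure_iff by blast
  then obtain r where r: "\<And>y. y \<in> K \<Longrightarrow> 0 < r y" "\<And>y. y \<in> K \<Longrightarrow> prob (E (ball y (r y))) = 0" by metis
  obtain F where F: "F \<subseteq> K" "finite F" "K \<subseteq> (\<Union>y\<in>F. ball y (r y))"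
    by (rule compactE_image[OF K, of K "\<lambda>y. ball y (r y)"]) (use r(1) in auto)
  have EM: "E (ball y (r y)) \<in> events" for y
    unfolding E_def by (intro staying_hit_event D T) auto
  have "E K \<subseteq> (\<Union>y\<in>F. E (ball y (r y)))" using F(3) unfolding E_def by blast
  then have "prob (E K) \<le> prob (\<Union>y\<in>F. E (ball y (r y)))"
    using EM F(2) by (intro finite_measure_mono sets.finite_UN) auto
  also have "\<dots> \<le> (\<Sum>y\<in>F. prob (E (ball y (r y))))"
    using EM F(2) by (intro finite_measure_subadditive_finite) auto
  also have "\<dots> = 0" using F r(2) by (intro sum.neutral) auto
  finally show False using pos by (simp add: E_def)
qed

lemma reachable_start:
  assumes "open D" "0 \<in> D"
  shows "reachable D 0"
  unfolding reachable_def
proof safe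
  fix r :: real assume r: "0 < r"
  have "AE \<omega> in M. \<omega> \<in> {\<omega> \<in> space M. (\<forall>s\<in>{0..0}. W s \<omega> \<in> D) \<and> W 0 \<omega> \<in> ball 0 r}"
    using start_W AE_space by eventually_elim (use assms r in auto)
  then have "prob {\<omega> \<in> space M. (\<forall>s\<in>{0..0}. W s \<omega> \<in> D) \<and> W 0 \<omega> \<in> ball 0 r} = 1"
    using staying_hit_event[OF assms(1), of 0 "ball 0 r"] by (subst prob_eq_1) auto
  then show "\<exists>T\<ge>0. 0 < prob {\<omega> \<in> space M. (\<forall>s\<in>{0..T}. W s \<omega> \<in> D) \<and> W T \<omega> \<in> ball 0 r}"
    by (intro exI[of _ 0]) auto
qed

text \<open>
  From a position within \<open>r\<close> of \<open>z\<close>, a step of length about \<open>g\<close> in the direction of \<open>w\<close> leads to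
  within \<open>d - g + g/2 + r\<close> of \<open>w\<close>, where \<open>d\<close> is the distance from \<open>z\<close> to \<open>w\<close>. The step is fixed first
  and \<open>r\<close> is then taken small in comparison with it; only after that is the time \<open>T\<close> known.
\<close>

lemma reachable_closer:
  assumes D: "open D" and z: "reachable D z" "z \<in> D" and w: "z \<noteq> w"
  shows "\<exists>\<rho> < dist z w. \<exists>T\<ge>0. 0 < prob {\<omega> \<in> space M. (\<forall>s\<in>{0..T}. W s \<omega> \<in> D) \<and> W T \<omega> \<in> cball w \<rho>}"
proof -
  obtain \<eta> where \<eta>: "0 < \<eta>" "ball z \<eta> \<subseteq> D" using D z by (meson open_contains_ball)
  define d where "d = dist z w"
  have d: "0 < d" using w by (simp add: d_def)
  define u where "u = (w - z) /\<^sub>R d"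
  have u: "norm u = 1" "d *\<^sub>R u = w - z"
    using d by (auto simp: u_def d_def dist_norm norm_minus_commute)
  obtain h0 where h0: "0 < h0" and step: "\<And>h T A. 0 < h \<Longrightarrow> h \<le> h0 \<Longrightarrow> 0 \<le> T \<Longrightarrow> A \<in> sets (past M W T) \<Longrightarrow> 0 < prob A \<Longrightarrow>
    (\<exists>E\<in>events. 0 < prob E \<and> E \<subseteq> {\<omega> \<in> A. (\<forall>s\<in>{T..T+h}. norm (W s \<omega> - W T \<omega>) < \<eta>/2) \<and>
       norm (W (T + h) \<omega> - W T \<omega> - sqrt h *\<^sub>R u) \<le> sqrt h / 2})"
    using exists_short_step[OF u(1), of "\<eta>/2"] \<eta>(1) by auto
  define h where "h = min h0 (d\<^sup>2)"
  define g where "g = sqrt h"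
  have h: "0 < h" "h \<le> h0" using h0 d by (auto simp: h_def)
  have g: "0 < g" "g \<le> d" using h d real_sqrt_le_mono[of h "d\<^sup>2"] by (auto simp: g_def h_def)
  define r where "r = min (\<eta>/2) (g/4)"
  have r: "0 < r" "r \<le> \<eta>/2" "r \<le> g/4" using \<eta> g by (auto simp: r_def)
  obtain T where T: "0 \<le> T" and pos: "0 < prob {\<omega> \<in> space M. (\<forall>s\<in>{0..T}. W s \<omega> \<in> D) \<and> W T \<omega> \<in> ball z r}"
    using z(1) r(1) unfolding reachable_def by blast
  obtain E where E: "E \<in> events" "0 < prob E"
    "E \<subseteq> {\<omega> \<in> {\<omega> \<in> space M. (\<forall>s\<in>{0..T}. W s \<omega> \<in> D) \<and> W T \<omega> \<in> ball z r}.
       (\<forall>s\<in>{T..T+h}. norm (W s \<omega> - W T \<omega>) < \<eta>/2) \<and>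
       norm (W (T + h) \<omega> - W T \<omega> - sqrt h *\<^sub>R u) \<le> sqrt h / 2}"
    using step[OF h T staying_hit_past[OF D T, of "ball z r"] pos] by auto
  have "E \<subseteq> {\<omega> \<in> space M. (\<forall>s\<in>{0..T+h}. W s \<omega> \<in> D) \<and> W (T+h) \<omega> \<in> cball w (d - g/4)}"
  proof (intro subsetI CollectI conjI ballI)
    fix \<omega> assume "\<omega> \<in> E"
    then have \<omega>: "\<omega> \<in> space M" "\<And>s. s \<in> {0..T} \<Longrightarrow> W s \<omega> \<in> D" "dist z (W T \<omega>) < r"
       "\<And>s. s \<in> {T..T+h} \<Longrightarrow> norm (W s \<omega> - W T \<omega>) < \<eta>/2"
       "norm (W (T + h) \<omega> - W T \<omega> - g *\<^sub>R u) \<le> g / 2"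
      using E(3) by (auto simp: g_def)
    show "\<omega> \<in> space M" by fact
    have "dist w (W (T + h) \<omega>) = norm ((W (T + h) \<omega> - W T \<omega> - g *\<^sub>R u) + (W T \<omega> - z) + (g - d) *\<^sub>R u)"
      using u(2) by (simp add: dist_norm norm_minus_commute scaleR_diff_left algebra_simps)
    also have "\<dots> \<le> norm (W (T + h) \<omega> - W T \<omega> - g *\<^sub>R u) + norm (W T \<omega> - z) + norm ((g - d) *\<^sub>R u)"
      by (meson add_mono_thms_linordered_semiring(3) norm_triangle_ineq order_trans)
    also have "norm ((g - d) *\<^sub>R u) = d - g" using u(1) g by simp
    also have "norm (W T \<omega> - z) < r" using \<omega>(3) by (simp add: dist_norm norm_minus_commute)
    finally show "W (T + h) \<omega> \<in> cball w (d - g/4)" using \<omega>(5) r by simp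
    fix s assume s: "s \<in> {0..T+h}"
    show "W s \<omega> \<in> D"
    proof (cases "s \<le> T")
      case False
      then have "dist (W T \<omega>) (W s \<omega>) < \<eta>/2" using \<omega>(4)[of s] s by (simp add: dist_norm norm_minus_commute)
      then have "dist z (W s \<omega>) < \<eta>" using \<omega>(3) r dist_triangle[of z "W s \<omega>" "W T \<omega>"] by simp
      then show ?thesis using \<eta> by auto
    qed (use s \<omega> in auto)
  qed
  then have "prob E \<le> prob {\<omega> \<in> space M. (\<forall>s\<in>{0..T+h}. W s \<omega> \<in> D) \<and> W (T+h) \<omega> \<in> cball w (d - g/4)}"
    using T h by (intro finite_measure_mono staying_hit_event D) auto
  then show ?thesis using E(2) T h g unfolding d_def[symmetric]
    by (intro exI[of _ "d - g/4"] conjI exI[of _ "T+h"]) auto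
qed

text \<open>
  The reachable points of \<open>D\<close> form a relatively closed nonempty set. It is also open: if a point
  \<open>w\<close> close to a reachable point were not reachable, a reachable point nearest to \<open>w\<close> would exist,
  and a short step from it would produce a reachable point that is nearer still.
\<close>

lemma reachable_everywhere:
  assumes D: "open D" "connected D" "0 \<in> D" and z: "z \<in> D"
  shows "reachable D z"
proof -
  let ?R = "D \<inter> {z. reachable D z}"
  have "open ?R"
    unfolding open_contains_ball
  proof safe
    fix z assume z: "z \<in> D" "reachable D z"
    obtain e where e: "0 < e" "ball z e \<subseteq> D" using D(1) z by (meson open_contains_ball)
    have "w \<in> D \<and> reachable D w" if w: "w \<in> ball z (e/2)" for w
    proof
      show "w \<in> D" using w e by (auto simp: subset_eq)
      show "reachable D w"
      proof (rule ccontr)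
        assume nw: "\<not> reachable D w"
        obtain y where y: "y \<in> {z. reachable D z}" "\<And>x. x \<in> {z. reachable D z} \<Longrightarrow> dist w y \<le> dist w x"
          using distance_attains_inf[OF closed_reachable[OF D(1)], of w] z by blast
        have yw: "y \<noteq> w" using y nw by auto
        have "dist w y \<le> dist w z" using y z by auto
        then have "dist z y < e" using w dist_triangle[of z y w] by (simp add: dist_commute)
        then have "y \<in> D" using e by auto
        from reachable_closer[OF D(1) _ this yw] y(1)
        obtain \<rho> T where \<rho>: "\<rho> < dist y w" "0 \<le> T"
          "0 < prob {\<omega> \<in> space M. (\<forall>s\<in>{0..T}. W s \<omega> \<in> D) \<and> W T \<omega> \<in> cball w \<rho>}" by auto
        obtain x where "x \<in> cball w \<rho>" "reachable D x"
          using ex_reachable_in_compact[OF D(1) compact_cball \<rho>(2,3)] by blast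
        then show False using y(2)[of x] \<rho>(1) by (simp add: dist_commute)
      qed
    qed
    then show "\<exists>e>0. ball z e \<subseteq> ?R" using e(1) by (intro exI[of _ "e/2"]) auto
  qed
  then have "openin (top_of_set D) ?R" by (intro open_subset) auto
  moreover have "closedin (top_of_set D) ?R" using closed_reachable[OF D(1)] by (simp add: closedin_closed_Int)
  moreover have "?R \<noteq> {}" using reachable_start[OF D(1,3)] D(3) by auto
  ultimately have "?R = D" using D(2) unfolding connected_clopen by blast
  then show ?thesis using z by auto
qed

end

section \<open>Limits of centred square-integrable variables\<close>

text \<open>
  Apply Fatou's lemma to \<open>(X m + c)\<^sup>2\<close>, whose means are at most \<open>C + c\<^sup>2\<close>. Since the limit \<open>Y\<close> is
  nonnegative, \<open>(Y + c)\<^sup>2\<close> dominates \<open>2 * c * Y + c\<^sup>2\<close>, so the mean of \<open>Y\<close> is at most \<open>C / (2 * c)\<close>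
  for every \<open>c > 0\<close>. This replaces an argument by uniform integrability.
\<close>

lemma (in prob_space) centred_L2_bounded_limit_nonneg_imp_zero:
  fixes X :: "nat \<Rightarrow> 'a \<Rightarrow> real"
  assumes int: "\<And>m. integrable M (X m)" "\<And>m. expectation (X m) = 0"
    and sq: "\<And>m. integrable M (\<lambda>\<omega>. (X m \<omega>)\<^sup>2)" "\<And>m. expectation (\<lambda>\<omega>. (X m \<omega>)\<^sup>2) \<le> C"
    and lim: "AE \<omega> in M. (\<lambda>m. X m \<omega>) \<longlonglongrightarrow> Y \<omega>"
    and Y: "Y \<in> borel_measurable M" "AE \<omega> in M. 0 \<le> Y \<omega>"
  shows "AE \<omega> in M. Y \<omega> = 0"
proof -
  define I where "I = (\<integral>\<^sup>+\<omega>. ennreal (Y \<omega>) \<partial>M)"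
  have XM: "X m \<in> borel_measurable M" for m using int(1) by auto
  have C: "0 \<le> C" by (rule order_trans[OF Bochner_Integration.integral_nonneg sq(2)[of 0]]) simp
  have key: "ennreal (2 * c) * I \<le> ennreal C" if c: "0 < c" for c :: real
  proof -
    have m: "(\<integral>\<^sup>+\<omega>. ennreal ((X m \<omega> + c)\<^sup>2) \<partial>M) \<le> ennreal (C + c\<^sup>2)" for m
    proof -
      have e: "(\<lambda>\<omega>. (X m \<omega> + c)\<^sup>2) = (\<lambda>\<omega>. (X m \<omega>)\<^sup>2 + 2 * c * X m \<omega> + c\<^sup>2)"
        by (auto simp: power2_eq_square algebra_simps)
      have "integrable M (\<lambda>\<omega>. (X m \<omega> + c)\<^sup>2)" unfolding e using int sq by auto
      then have "(\<integral>\<^sup>+\<omega>. ennreal ((X m \<omega> + c)\<^sup>2) \<partial>M) = ennreal (expectation (\<lambda>\<omega>. (X m \<omega> + c)\<^sup>2))"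
        by (intro nn_integral_eq_integral) auto
      also have "expectation (\<lambda>\<omega>. (X m \<omega> + c)\<^sup>2) = expectation (\<lambda>\<omega>. (X m \<omega>)\<^sup>2) + c\<^sup>2"
        unfolding e using int sq by (simp add: prob_space)
      finally show ?thesis using sq(2)[of m] by (simp add: ennreal_leI del: ennreal_plus)
    qed
    have "ennreal (2 * c) * I + ennreal (c\<^sup>2) = (\<integral>\<^sup>+\<omega>. ennreal (2 * c) * ennreal (Y \<omega>) + ennreal (c\<^sup>2) \<partial>M)"
      unfolding I_def using Y(1) by (subst nn_integral_add) (auto simp: nn_integral_cmult emeasure_space_1)
    also have "\<dots> \<le> (\<integral>\<^sup>+\<omega>. ennreal ((Y \<omega> + c)\<^sup>2) \<partial>M)"
    proof (rule nn_integral_mono_AE, use Y(2) in eventually_elim)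
      fix \<omega> assume y: "0 \<le> Y \<omega>"
      have "2 * c * Y \<omega> + c\<^sup>2 \<le> (Y \<omega> + c)\<^sup>2" by (simp add: power2_eq_square algebra_simps)
      then show "ennreal (2 * c) * ennreal (Y \<omega>) + ennreal (c\<^sup>2) \<le> ennreal ((Y \<omega> + c)\<^sup>2)"
        using y c by (simp add: ennreal_mult[symmetric] ennreal_plus[symmetric] ennreal_leI del: ennreal_plus)
    qed
    also have "\<dots> = (\<integral>\<^sup>+\<omega>. liminf (\<lambda>m. ennreal ((X m \<omega> + c)\<^sup>2)) \<partial>M)"
    proof (rule nn_integral_cong_AE, use lim in eventually_elim)
      fix \<omega> assume "(\<lambda>m. X m \<omega>) \<longlonglongrightarrow> Y \<omega>"
      then have "(\<lambda>m. ennreal ((X m \<omega> + c)\<^sup>2)) \<longlonglongrightarrow> ennreal ((Y \<omega> + c)\<^sup>2)"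
        by (intro tendsto_ennrealI tendsto_intros)
      then show "ennreal ((Y \<omega> + c)\<^sup>2) = liminf (\<lambda>m. ennreal ((X m \<omega> + c)\<^sup>2))"
        by (rule lim_imp_Liminf[OF sequentially_bot, symmetric])
    qed
    also have "\<dots> \<le> liminf (\<lambda>m. \<integral>\<^sup>+\<omega>. ennreal ((X m \<omega> + c)\<^sup>2) \<partial>M)"
      using XM by (intro nn_integral_liminf) auto
    also have "\<dots> \<le> ennreal (C + c\<^sup>2)"
      using m by (intro Liminf_le always_eventually) auto
    also have "\<dots> = ennreal C + ennreal (c\<^sup>2)" using C by simp
    finally show ?thesis by (simp add: ennreal_add_left_cancel_le add.commute)
  qed
  have "I = 0"
  proof -
    have "I \<noteq> \<infinity>" using key[of 1] by (auto simp: ennreal_mult_top top_unique)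
    then obtain i where i: "I = ennreal i" "0 \<le> i" by (cases I) auto
    have k: "2 * c * i \<le> C" if "0 < c" for c
      using key[OF that] that i C by (simp add: ennreal_mult[symmetric])
    have "i = 0"
    proof (rule ccontr)
      assume "i \<noteq> 0"
      then have "0 < i" using i by simp
      \<comment> \<open>This value of \<open>c\<close> turns the bound into \<open>2 * (C + 1) \<le> C\<close>.\<close>
      then show False using k[of "(C + 1) / i"] C by simp
    qed
    then show ?thesis using i by simp
  qed
  then have "AE \<omega> in M. ennreal (Y \<omega>) = 0"
    unfolding I_def using Y(1) by (subst (asm) nn_integral_0_iff_AE) auto
  then show ?thesis using Y(2) by eventually_elim (simp add: ennreal_eq_0_iff)
qed

section \<open>Recurrence\<close>

text \<open>
  Suppose that the motion has stayed above \<open>l\<close> up to time \<open>n\<close>. Up to an event of probability \<open>\<epsilon>\<close> it is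
  below some \<open>m\<close> then, and over a sufficiently long time \<open>h\<close> an increment below \<open>-sqrt h\<close>, hence
  below \<open>l - m\<close>, has at least a probability \<open>q\<close> that depends neither on \<open>n\<close> nor on \<open>\<epsilon>\<close>. So staying above \<open>l\<close>
  forever has a probability that does not exceed \<open>1 - q\<close> times itself.
\<close>

lemma (in brownian_wrt_filtration) AE_below_level:
  "AE \<omega> in M. \<exists>n::nat. X (real n) \<omega> < l"
proof -
  define A where "A n = {\<omega> \<in> space M. \<forall>k\<in>{..n}. l \<le> X (real k) \<omega>}" for n :: nat
  have AF: "A n \<in> sets (F (real n))" for n
  proof -
    have "{\<omega> \<in> space (F (real n)). \<forall>k\<in>{..n}. l \<le> X (real k) \<omega>} \<in> sets (F (real n))"
      by (intro sets.sets_Collect_finite_All borel_measurable_le adapted borel_measurable_const) auto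
    then show ?thesis by (simp add: A_def space_F)
  qed
  have AM: "A n \<in> events" for n using events_F[OF _ AF] by simp
  define q where "q = measure (density lborel std_normal_density) {-2<..<-1::real}"
  have q: "0 < q" unfolding q_def by (rule std_normal_interval_pos) simp
  let ?A = "\<Inter>n. A n"
  have decA: "decseq A" by (auto simp: decseq_def A_def)
  have lim: "(\<lambda>n. prob (A n)) \<longlonglongrightarrow> prob ?A"
    using AM decA by (intro finite_Lim_measure_decseq) auto
  have step: "prob ?A \<le> prob (A n) * (1 - q) + \<epsilon>" if \<epsilon>: "0 < \<epsilon>" for n \<epsilon>
  proof -
    define B where "B m = {\<omega> \<in> space M. real m < X (real n) \<omega>}" for m :: nat
    have BM: "B m \<in> events" for m
      unfolding B_def using measurable_X[of "real n"] by (intro borel_measurable_less) auto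
    have "decseq B" by (auto simp: decseq_def B_def)
    moreover have "(\<Inter>m. B m) = {}"
    proof -
      have "\<omega> \<notin> (\<Inter>m. B m)" for \<omega>
        using reals_Archimedean2[of "X (real n) \<omega>"] by (auto simp: B_def intro: less_asym)
      then show ?thesis by blast
    qed
    ultimately have "(\<lambda>m. prob (B m)) \<longlonglongrightarrow> 0"
      using finite_Lim_measure_decseq[of B] BM by auto
    then have "eventually (\<lambda>m. prob (B m) < \<epsilon>) sequentially" using \<epsilon> by (rule order_tendstoD)
    then obtain m where m: "prob (B m) < \<epsilon>" unfolding eventually_sequentially by blast
    define h :: nat where "h = nat \<lceil>(real m - l)\<^sup>2\<rceil> + 1"
    have h: "(real m - l)\<^sup>2 \<le> real h" "0 < real h" unfolding h_def by linarith+
    have hs: "real m - l \<le> sqrt (real h)" using h(1) real_le_rsqrt by blast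
    define G where "G = {\<omega> \<in> space M. X (real n + real h) \<omega> - X (real n) \<omega> \<in> {sqrt (real h) * (-2)<..<sqrt (real h) * (-1)}}"
    define G' where "G' = {\<omega> \<in> space M. X (real n + real h) \<omega> - X (real n) \<omega> \<in> - {sqrt (real h) * (-2)<..<sqrt (real h) * (-1)}}"
    have GM: "G \<in> events" "G' \<in> events"
      unfolding G_def G'_def using measurable_X
      by (intro measurable_sets_Collect_mem[of _ _ borel] borel_measurable_diff; auto)+
    have "prob G' = 1 - prob G"
      using prob_compl[OF GM(1)] by (simp add: G_def G'_def set_diff_eq cong: conj_cong)
    also have "prob G = q" unfolding G_def q_def using h by (intro prob_scaled_increment) auto
    finally have G': "prob G' = 1 - q" .
    have "?A \<subseteq> (A n \<inter> G') \<union> B m"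
    proof
      fix \<omega> assume \<omega>: "\<omega> \<in> ?A"
      then have sp: "\<omega> \<in> space M" by (auto simp: A_def)
      have "\<omega> \<in> A (n + h)" using \<omega> by blast
      then have "l \<le> X (real n + real h) \<omega>" by (auto simp: A_def dest!: bspec[of _ _ "n + h"])
      then have "\<omega> \<in> G' \<or> \<omega> \<in> B m" using hs sp by (auto simp: G'_def B_def)
      then show "\<omega> \<in> (A n \<inter> G') \<union> B m" using \<omega> by blast
    qed
    then have "prob ?A \<le> prob ((A n \<inter> G') \<union> B m)"
      using AM GM BM by (intro finite_measure_mono) auto
    also have "\<dots> \<le> prob (A n \<inter> G') + prob (B m)"
      using AM GM BM by (intro measure_Un_le) auto
    also have "prob (A n \<inter> G') = prob (A n) * (1 - q)"
      unfolding G'[symmetric] unfolding G'_def by (rule increment_indep) (use AF in auto)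
    finally show ?thesis using m by simp
  qed
  have "prob ?A \<le> prob ?A * (1 - q) + \<epsilon>" if "0 < \<epsilon>" for \<epsilon>
    by (rule LIMSEQ_le_const[OF tendsto_add[OF tendsto_mult[OF lim tendsto_const] tendsto_const]])
      (use step[OF that] in auto)
  then have "prob ?A \<le> prob ?A * (1 - q)" by (rule field_le_epsilon)
  then have "prob ?A * q \<le> 0" by (simp add: algebra_simps)
  then have "prob ?A \<le> 0" using q by (simp add: mult_le_0_iff)
  then have "prob ?A = 0" by (simp add: order_antisym)
  then have "AE \<omega> in M. \<omega> \<notin> ?A" using AM by (intro AE_not_in) (auto simp: null_sets_def emeasure_eq_measure)
  then show ?thesis using AE_space
    by eventually_elim (auto simp: A_def not_le)
qed

section \<open>The exit time\<close>

context complex_brownian_motion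
begin

text \<open>
  The complement of \<open>D\<close> is closed and paths are continuous, so the infimum in the exit time is
  attained; this gives the strict inequality on the left.
\<close>

lemma less_exit_time_iff:
  assumes D: "open D" and \<omega>: "\<omega> \<in> space M" and t: "0 \<le> t"
  shows "ennreal t < exit_time W D \<omega> \<longleftrightarrow> (\<forall>s\<in>{0..t}. W s \<omega> \<in> D)"
proof
  assume lt: "ennreal t < exit_time W D \<omega>"
  show "\<forall>s\<in>{0..t}. W s \<omega> \<in> D"
  proof (rule ballI, rule ccontr)
    fix s assume s: "s \<in> {0..t}" "W s \<omega> \<notin> D"
    then have "exit_time W D \<omega> \<le> ennreal s" unfolding exit_time_def by (intro Inf_lower) auto
    also have "\<dots> \<le> ennreal t" using s by (intro ennreal_leI) auto
    finally show False using lt by simp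
  qed
next
  assume stay: "\<forall>s\<in>{0..t}. W s \<omega> \<in> D"
  define Z where "Z = {s. 0 \<le> s \<and> W s \<omega> \<notin> D}"
  show "ennreal t < exit_time W D \<omega>"
  proof (cases "Z = {}")
    case True
    then show ?thesis unfolding exit_time_def Z_def[symmetric] by simp
  next
    case False
    have "Z = (\<lambda>s. W s \<omega>) -` (- D) \<inter> {0..}" by (auto simp: Z_def)
    moreover have "closed ((\<lambda>s. W s \<omega>) -` (- D) \<inter> {0..})"
      using continuous_W[OF \<omega>] D by (subst (asm) continuous_on_closed_vimage) auto
    ultimately have "closed Z" by simp
    moreover have bdd: "bdd_below Z" by (intro bdd_belowI[of _ 0]) (auto simp: Z_def)
    ultimately have "Inf Z \<in> Z" using False by (intro closed_contains_Inf)
    then have "t < Inf Z" using stay by (force simp: Z_def)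
    then have "ennreal t < ennreal (Inf Z)" using t by (simp add: ennreal_less_iff)
    also have "\<dots> \<le> exit_time W D \<omega>"
      unfolding exit_time_def Z_def[symmetric] using bdd by (auto intro!: Inf_greatest ennreal_leI cInf_lower)
    finally show ?thesis .
  qed
qed

lemma exit_time_finite:
  assumes D: "open D" and \<omega>: "\<omega> \<in> space M" and fin: "exit_time W D \<omega> < \<infinity>"
  defines "\<tau> \<equiv> enn2real (exit_time W D \<omega>)"
  shows "exit_time W D \<omega> = ennreal \<tau>" "0 \<le> \<tau>" "W \<tau> \<omega> \<notin> D" "\<And>s. 0 \<le> s \<Longrightarrow> s < \<tau> \<Longrightarrow> W s \<omega> \<in> D"
proof -
  show e: "exit_time W D \<omega> = ennreal \<tau>" and t0: "0 \<le> \<tau>" using fin by (auto simp: \<tau>_def less_top)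
  show s: "W s \<omega> \<in> D" if "0 \<le> s" "s < \<tau>" for s
    using less_exit_time_iff[OF D \<omega> that(1)] that by (auto simp: e ennreal_less_iff)
  show "W \<tau> \<omega> \<notin> D"
  proof
    assume "W \<tau> \<omega> \<in> D"
    then have "\<forall>s\<in>{0..\<tau>}. W s \<omega> \<in> D" using s by (force simp: le_less)
    then show False using less_exit_time_iff[OF D \<omega> t0] by (simp add: e)
  qed
qed

lemma measurable_exit_time:
  assumes D: "open D"
  shows "exit_time W D \<in> borel_measurable M"
proof (rule borel_measurableI_greater)
  fix y :: ennreal
  show "{\<omega> \<in> space M. y < exit_time W D \<omega>} \<in> events"
  proof (cases y)
    case (real t)
    then have "{\<omega> \<in> space M. y < exit_time W D \<omega>} = {\<omega> \<in> space M. \<forall>s\<in>{0..t}. W s \<omega> \<in> D}"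
      using less_exit_time_iff[OF D] by auto
    then show ?thesis using stays_in_past[OF D, of t] past_events[OF real(1)] by auto
  qed auto
qed

lemma AE_exit_Re_event:
  assumes "prob (exit_Re_event M W D A) = 1"
  shows "AE \<omega> in M. exit_time W D \<omega> < \<infinity> \<and> Re (W (enn2real (exit_time W D \<omega>)) \<omega>) \<in> A"
  using AE_prob_1[OF assms] by eventually_elim (auto simp: exit_Re_event_def)

text \<open>
  Optional stopping. Let \<open>A\<close> be the event in question. The increments of the real part over the grid
  \<open>T + k / (m + 1)\<close>, summed as long as \<open>D\<close> has not been left and restricted to \<open>A\<close>, are centred; their
  second moments are bounded by the mean exit time plus 1; and they converge to the real part at the
  exit minus the real part at time \<open>T\<close>. On \<open>A\<close> this limit is positive, so \<open>A\<close> must be null.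
\<close>

lemma stopped_Re_lower_bound:
  assumes D: "open D" and fin: "(\<integral>\<^sup>+ \<omega>. exit_time W D \<omega> \<partial>M) < \<infinity>"
    and low: "AE \<omega> in M. x \<le> Re (W (enn2real (exit_time W D \<omega>)) \<omega>)"
    and T: "0 \<le> T"
  shows "prob {\<omega> \<in> space M. (\<forall>s\<in>{0..T}. W s \<omega> \<in> D) \<and> W T \<omega> \<in> {z. Re z < x}} = 0"
proof -
  have half: "open {z. Re z < x}" by (rule open_halfspace_Re_lt)
  define A where "A = {\<omega> \<in> space M. (\<forall>s\<in>{0..T}. W s \<omega> \<in> D) \<and> W T \<omega> \<in> {z. Re z < x}}"
  have A: "A \<in> sets (past M W T)" "A \<in> events" "A \<subseteq> space M"
    using staying_hit_past[OF D T borel_open[OF half]] staying_hit_event[OF D T borel_open[OF half]]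
    by (auto simp: A_def)
  define \<tau> where "\<tau> \<omega> = enn2real (exit_time W D \<omega>)" for \<omega>
  define Fin where "Fin = {\<omega> \<in> space M. exit_time W D \<omega> < \<infinity>}"
  have FinM: "Fin \<in> events" unfolding Fin_def using measurable_exit_time[OF D] by measurable
  have AEF: "AE \<omega> in M. \<omega> \<in> Fin"
    using nn_integral_PInf_AE[OF measurable_exit_time[OF D]] fin AE_space
    by (auto simp: Fin_def less_top elim!: eventually_mono)
  define t where "t m k = T + real k * (1 / Suc m)" for m k :: nat
  have t: "mono (t m)" "0 \<le> t m 0" "T \<le> t m k" "0 \<le> t m k" for m k
    using T by (auto simp: t_def mono_def divide_right_mono)
  have dt: "t m (Suc k) - t m k = 1 / Suc m" for m k
    by (simp add: t_def add_divide_distrib)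
  \<comment> \<open>The grid of mesh \<open>1 / Suc m\<close> extends over a time span \<open>Suc m\<close>, so it becomes finer and longer.\<close>
  define N where "N m = Suc m * Suc m" for m
  define E where "E m k = A \<inter> {\<omega> \<in> space M. \<forall>s\<in>{0..t m k}. W s \<omega> \<in> D}" for m k
  have EF: "E m k \<in> sets (past M W (t m k))" for m k
    unfolding E_def by (intro sets.Int stays_in_past[OF D] subsetD[OF past_mono[OF t(3)] A(1)])
  have EM: "E m k \<in> events" for m k using EF past_events[OF t(4)] by blast
  define Y where "Y m \<omega> = (\<Sum>k<N m. indicator (E m k) \<omega> * (Re (W (t m (Suc k)) \<omega>) - Re (W (t m k) \<omega>)))" for m \<omega>
  note Ym = re_past.predictable_sum_moments[OF t(1,2) EF, of m "N m" for m, folded Y_def]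
  have E_iff: "\<omega> \<in> E m k \<longleftrightarrow> \<omega> \<in> A \<and> t m k < \<tau> \<omega>" if "\<omega> \<in> Fin" for \<omega> m k
  proof -
    have \<omega>: "\<omega> \<in> space M" "exit_time W D \<omega> < \<infinity>" using that by (auto simp: Fin_def)
    then have "exit_time W D \<omega> = ennreal (\<tau> \<omega>)" using exit_time_finite[OF D] by (simp add: \<tau>_def)
    then show ?thesis using less_exit_time_iff[OF D \<omega>(1) t(4), of m k] \<omega> t(4)[of m k]
      by (auto simp: E_def ennreal_less_iff)
  qed
  define C where "C = enn2real (\<integral>\<^sup>+ \<omega>. exit_time W D \<omega> \<partial>M) + 1"
  have sq: "expectation (\<lambda>\<omega>. (Y m \<omega>)\<^sup>2) \<le> C" for m
  proof -
    have "ennreal (expectation (\<lambda>\<omega>. (Y m \<omega>)\<^sup>2)) = (\<Sum>k<N m. ennreal (1 / Suc m) * emeasure M (E m k))"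
      unfolding Ym(5) dt
      by (simp add: emeasure_eq_measure sum_ennreal[symmetric] ennreal_mult[symmetric] mult.commute del: sum_ennreal)
    also have "\<dots> = (\<integral>\<^sup>+\<omega>. (\<Sum>k<N m. ennreal (1 / Suc m) * indicator (E m k) \<omega>) \<partial>M)"
      using EM by (subst nn_integral_sum) (auto simp: nn_integral_cmult_indicator)
    also have "\<dots> \<le> (\<integral>\<^sup>+\<omega>. exit_time W D \<omega> + 1 \<partial>M)"
    proof (rule nn_integral_mono_AE, use AEF in eventually_elim)
      fix \<omega> assume \<omega>: "\<omega> \<in> Fin"
      define K where "K = nat \<lceil>\<tau> \<omega> * Suc m\<rceil>"
      have e: "exit_time W D \<omega> = ennreal (\<tau> \<omega>)" "0 \<le> \<tau> \<omega>"
        using \<omega> exit_time_finite[OF D] by (auto simp: \<tau>_def Fin_def)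
      have "k < K" if "\<omega> \<in> E m k" for k
      proof -
        have "real k * (1 / Suc m) < \<tau> \<omega>" using that \<omega> T by (simp add: E_iff t_def)
        then have "real k < \<tau> \<omega> * Suc m" by (simp add: field_simps)
        then show ?thesis unfolding K_def by linarith
      qed
      then have "(\<Sum>k<N m. ennreal (1 / Suc m) * indicator (E m k) \<omega>) \<le> (\<Sum>k<N m. if k \<in> {..<K} then ennreal (1 / Suc m) else 0)"
        by (intro sum_mono) (auto simp: indicator_def)
      also have "\<dots> = (\<Sum>k\<in>{..<N m} \<inter> {..<K}. ennreal (1 / Suc m))"
        by (simp only: sum.inter_restrict[OF finite_lessThan])
      also have "\<dots> \<le> (\<Sum>k<K. ennreal (1 / Suc m))" by (intro sum_mono2) auto
      also have "\<dots> = ennreal (real K * (1 / Suc m))"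
        by (simp add: ennreal_of_nat_eq_real_of_nat ennreal_mult[symmetric])
      also have "\<dots> \<le> ennreal (\<tau> \<omega> + 1)"
      proof (rule ennreal_leI)
        have "real K \<le> \<tau> \<omega> * Suc m + 1" unfolding K_def using e(2) by (simp add: nat_ceiling_le_eq)
        also have "\<dots> \<le> (\<tau> \<omega> + 1) * Suc m" by (simp add: algebra_simps)
        finally show "real K * (1 / Suc m) \<le> \<tau> \<omega> + 1" by (simp add: field_simps)
      qed
      also have "\<dots> = exit_time W D \<omega> + 1" using e by simp
      finally show "(\<Sum>k<N m. ennreal (1 / Suc m) * indicator (E m k) \<omega>) \<le> exit_time W D \<omega> + 1" .
    qed
    also have "\<dots> = ennreal C"
      using fin measurable_exit_time[OF D] by (subst nn_integral_add) (auto simp: C_def emeasure_space_1 less_top)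
    finally show ?thesis by (simp add: ennreal_le_iff[of C] C_def del: ennreal_plus)
  qed
  \<comment> \<open>The limit of the sums, set to 0 on the null set where the exit time is infinite.\<close>
  define Z where "Z \<omega> = (if \<omega> \<in> Fin then indicator A \<omega> * (Re (W (\<tau> \<omega>) \<omega>) - Re (W T \<omega>)) else 0)" for \<omega>
  have conv: "(\<lambda>m. Y m \<omega>) \<longlonglongrightarrow> Z \<omega>" if \<omega>: "\<omega> \<in> Fin" for \<omega>
  proof (cases "\<omega> \<in> A")
    case False
    then show ?thesis using \<omega> by (simp add: Y_def Z_def E_def)
  next
    case True
    have sp: "\<omega> \<in> space M" using True A by auto
    \<comment> \<open>The number of steps until the first grid time after the exit.\<close>
    define K where "K m = nat \<lceil>(\<tau> \<omega> - T) * Suc m\<rceil>" for m :: nat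
    have "\<omega> \<in> E 0 0" using True by (auto simp: E_def A_def t_def)
    then have T\<tau>: "T < \<tau> \<omega>" using E_iff[OF \<omega>, of 0 0] by (simp add: t_def)
    have Ek: "\<omega> \<in> E m k \<longleftrightarrow> k < K m" for m k
    proof -
      have "\<omega> \<in> E m k \<longleftrightarrow> real k * (1 / Suc m) < \<tau> \<omega> - T" using True by (auto simp: E_iff[OF \<omega>] t_def)
      also have "\<dots> \<longleftrightarrow> real k < (\<tau> \<omega> - T) * Suc m" by (simp add: field_simps)
      also have "\<dots> \<longleftrightarrow> k < K m" unfolding K_def by linarith
      finally show ?thesis .
    qed
    have Kb: "(\<tau> \<omega> - T) * Suc m \<le> real (K m)" "real (K m) \<le> (\<tau> \<omega> - T) * Suc m + 1" for m
    proof -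
      have "0 \<le> (\<tau> \<omega> - T) * Suc m" using T\<tau> by simp
      then show "(\<tau> \<omega> - T) * Suc m \<le> real (K m)" "real (K m) \<le> (\<tau> \<omega> - T) * Suc m + 1"
        unfolding K_def by linarith+
    qed
    have tK: "\<tau> \<omega> \<le> t m (K m)" "t m (K m) \<le> \<tau> \<omega> + 1 / Suc m" for m
    proof -
      have "(\<tau> \<omega> - T) * Suc m / Suc m \<le> real (K m) / Suc m"
        "real (K m) / Suc m \<le> ((\<tau> \<omega> - T) * Suc m + 1) / Suc m"
        using Kb[of m] by (intro divide_right_mono; simp)+
      then have "\<tau> \<omega> - T \<le> real (K m) / Suc m" "real (K m) / Suc m \<le> \<tau> \<omega> - T + 1 / Suc m"
        by (simp_all only: add_divide_distrib nonzero_mult_div_cancel_right of_nat_eq_0_iff nat.distinct not_False_eq_True)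
      then show "\<tau> \<omega> \<le> t m (K m)" "t m (K m) \<le> \<tau> \<omega> + 1 / Suc m"
        by (simp_all add: t_def)
    qed
    have YK: "Y m \<omega> = Re (W (t m (K m)) \<omega>) - Re (W T \<omega>)" if m: "\<tau> \<omega> - T \<le> real m" for m
    proof -
      have "(\<tau> \<omega> - T) * Suc m \<le> real m * Suc m" using m by (intro mult_right_mono) auto
      then have "real (K m) \<le> real (N m)" using Kb(2)[of m] by (simp add: N_def algebra_simps)
      then have KN: "K m \<le> N m" by simp
      have "Y m \<omega> = (\<Sum>k<N m. if k \<in> {..<K m} then Re (W (t m (Suc k)) \<omega>) - Re (W (t m k) \<omega>) else 0)"
        unfolding Y_def by (intro sum.cong) (auto simp: Ek)
      also have "\<dots> = (\<Sum>k\<in>{..<N m} \<inter> {..<K m}. Re (W (t m (Suc k)) \<omega>) - Re (W (t m k) \<omega>))"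
        by (simp only: sum.inter_restrict[OF finite_lessThan])
      also have "{..<N m} \<inter> {..<K m} = {..<K m}" using KN by auto
      also have "(\<Sum>k<K m. Re (W (t m (Suc k)) \<omega>) - Re (W (t m k) \<omega>)) = Re (W (t m (K m)) \<omega>) - Re (W (t m 0) \<omega>)"
        by (rule sum_lessThan_telescope[of "\<lambda>k. Re (W (t m k) \<omega>)"])
      finally show ?thesis by (simp add: t_def)
    qed
    have "(\<lambda>m. \<tau> \<omega> + 1 / real (Suc m)) \<longlonglongrightarrow> \<tau> \<omega>"
      using tendsto_add[OF tendsto_const LIMSEQ_inverse_real_of_nat, of "\<tau> \<omega>"] by (simp add: divide_inverse)
    then have "(\<lambda>m. t m (K m)) \<longlonglongrightarrow> \<tau> \<omega>"
      by (rule tendsto_sandwich[OF always_eventually[OF allI[OF tK(1)]] always_eventually[OF allI[OF tK(2)]]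
            tendsto_const])
    then have "(\<lambda>m. Re (W (t m (K m)) \<omega>)) \<longlonglongrightarrow> Re (W (\<tau> \<omega>) \<omega>)"
      using continuous_on_tendsto_compose[OF re.continuous_paths[OF sp], of "\<lambda>m. t m (K m)" "\<tau> \<omega>"] T T\<tau> t(4)
      by (simp add: always_eventually)
    then have "(\<lambda>m. Re (W (t m (K m)) \<omega>) - Re (W T \<omega>)) \<longlonglongrightarrow> Re (W (\<tau> \<omega>) \<omega>) - Re (W T \<omega>)"
      by (intro tendsto_diff tendsto_const)
    moreover obtain m0 :: nat where "\<tau> \<omega> - T \<le> real m0" using real_arch_simple by blast
    then have "eventually (\<lambda>m. Y m \<omega> = Re (W (t m (K m)) \<omega>) - Re (W T \<omega>)) sequentially"
      unfolding eventually_sequentially by (intro exI[of _ m0] allI impI YK) simp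
    ultimately have "(\<lambda>m. Y m \<omega>) \<longlonglongrightarrow> Re (W (\<tau> \<omega>) \<omega>) - Re (W T \<omega>)"
      by (simp add: tendsto_cong)
    then show ?thesis using \<omega> True by (simp add: Z_def)
  qed
  have YM: "(\<lambda>\<omega>. indicator Fin \<omega> * Y m \<omega>) \<in> borel_measurable M" for m
    using FinM borel_measurable_integrable[OF Ym(2)] by auto
  have "(\<lambda>m. indicator Fin \<omega> * Y m \<omega>) \<longlonglongrightarrow> Z \<omega>" for \<omega>
    using conv[of \<omega>] by (cases "\<omega> \<in> Fin") (simp_all add: Z_def)
  then have ZM: "Z \<in> borel_measurable M"
    by (rule borel_measurable_LIMSEQ_real[OF _ YM])
  have "AE \<omega> in M. 0 \<le> Z \<omega>"
    using low AEF by eventually_elim (auto simp: Z_def A_def \<tau>_def indicator_def)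
  moreover have "AE \<omega> in M. (\<lambda>m. Y m \<omega>) \<longlonglongrightarrow> Z \<omega>"
    using AEF by eventually_elim (rule conv)
  ultimately have "AE \<omega> in M. Z \<omega> = 0"
    by (intro centred_L2_bounded_limit_nonneg_imp_zero[where X = Y and C = C] Ym(2-4) sq ZM)
  with low AEF have "AE \<omega> in M. \<omega> \<notin> A"
    by eventually_elim (auto simp: Z_def A_def \<tau>_def indicator_def split: if_splits)
  then have "prob A = 0" using A(2) AE_iff_null_sets[of A M] by (auto simp: null_sets_def measure_def)
  then show ?thesis by (simp add: A_def)
qed

end

section \<open>The left end of the exit distribution\<close>

context complex_brownian_motion
begin

lemma AE_exit_time_finite:
  assumes D: "open D" and left: "\<And>z. z \<in> D \<Longrightarrow> l < Re z"
  shows "AE \<omega> in M. exit_time W D \<omega> < \<infinity>"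
  using re_past.AE_below_level[of l] AE_space
proof eventually_elim
  fix \<omega> assume "\<exists>n::nat. Re (W (real n) \<omega>) < l" and \<omega>: "\<omega> \<in> space M"
  then obtain n :: nat where "W (real n) \<omega> \<notin> D" using left by (meson less_asym)
  then have "\<not> ennreal (real n) < exit_time W D \<omega>"
    using less_exit_time_iff[OF D \<omega>, of "real n"] by auto
  then have "exit_time W D \<omega> \<le> ennreal (real n)" by simp
  also have "\<dots> < \<infinity>" by simp
  finally show "exit_time W D \<omega> < \<infinity>" .
qed

text \<open>
  The exit position is a limit of positions in \<open>D\<close>, unless the path starts outside \<open>D\<close>. The latter
  has probability 0 but may happen, since the motion starts at 0 only almost surely, and it has to be
  kept track of for the event to be measurable.
\<close>

lemma prob_exit_Re_event_left_end:
  assumes D: "open D" "0 \<in> D" and left: "\<And>z. z \<in> D \<Longrightarrow> l < Re z"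
  shows "prob (exit_Re_event M W D {l..}) = 1"
proof -
  have split: "exit_Re_event M W D {l..} =
    {\<omega> \<in> space M. exit_time W D \<omega> < \<infinity> \<and> (W 0 \<omega> \<in> D \<or> l \<le> Re (W 0 \<omega>))}"
  proof -
    have "l \<le> Re (W (enn2real (exit_time W D \<omega>)) \<omega>) \<longleftrightarrow> W 0 \<omega> \<in> D \<or> l \<le> Re (W 0 \<omega>)"
      if \<omega>: "\<omega> \<in> space M" and fin: "exit_time W D \<omega> < \<infinity>" for \<omega>
    proof -
      define \<tau> where "\<tau> = enn2real (exit_time W D \<omega>)"
      note \<tau> = exit_time_finite[OF D(1) \<omega> fin, folded \<tau>_def]
      show ?thesis
      proof (cases "\<tau> = 0")
        case True
        then show ?thesis using \<tau>(3) unfolding \<tau>_def[symmetric] by simp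
      next
        case False
        then have pos: "0 < \<tau>" using \<tau>(2) by simp
        define s where "s n = \<tau> - \<tau> / real (Suc n)" for n
        have s: "0 \<le> s n" "s n < \<tau>" for n using pos by (auto simp: s_def field_simps)
        have "s \<longlonglongrightarrow> \<tau> - \<tau> * 0"
          unfolding s_def divide_inverse
          by (intro tendsto_diff tendsto_mult tendsto_const LIMSEQ_inverse_real_of_nat)
        then have "(\<lambda>n. Re (W (s n) \<omega>)) \<longlonglongrightarrow> Re (W \<tau> \<omega>)"
          using continuous_on_tendsto_compose[OF re.continuous_paths[OF \<omega>], of s \<tau>] s(1) pos
          by (simp add: always_eventually)
        moreover have "l \<le> Re (W (s n) \<omega>)" for n by (rule less_imp_le[OF left[OF \<tau>(4)[OF s]]])
        ultimately have "l \<le> Re (W \<tau> \<omega>)" by (intro LIMSEQ_le_const) auto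
        then show ?thesis using \<tau>(4)[of 0] pos unfolding \<tau>_def[symmetric] by simp
      qed
    qed
    then show ?thesis unfolding exit_Re_event_def by auto
  qed
  have "W 0 \<in> borel_measurable M" "(\<lambda>\<omega>. Re (W 0 \<omega>)) \<in> borel_measurable M"
    using measurable_W[of 0] re.random_variable[of 0] by auto
  then have "exit_Re_event M W D {l..} \<in> events"
    unfolding split using measurable_exit_time[OF D(1)] borel_open[OF D(1)]
    by (intro sets.sets_Collect_conj sets.sets_Collect_disj measurable_sets_Collect_mem[of "W 0" _ borel]
        borel_measurable_less borel_measurable_le) auto
  moreover have "AE \<omega> in M. exit_time W D \<omega> < \<infinity>"
    by (rule AE_exit_time_finite[OF D(1)]) (rule left)
  then have "AE \<omega> in M. \<omega> \<in> exit_Re_event M W D {l..}"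
    using start_W AE_space
    by eventually_elim (use D(2) in \<open>auto simp: split\<close>)
  ultimately show ?thesis by (simp add: prob_eq_1)
qed

text \<open>
  Add the half-plane \<open>H\<close> to the left of \<open>x\<close> to \<open>D\<close>. The union is still a domain, and it contains a disc
  outside \<open>D\<close>. With positive probability the motion gets into that disc without leaving the union.
  On the way it has left \<open>D\<close>, and it can have done so only inside \<open>H\<close>.
\<close>

lemma exit_left_of_level_if_bounded_left:
  assumes D: "open D" "connected D" "0 \<in> D" and left: "\<And>z. z \<in> D \<Longrightarrow> l < Re z"
    and z: "z \<in> D" "Re z < x"
  shows "prob (exit_Re_event M W D {x..}) \<noteq> 1"
proof
  assume "prob (exit_Re_event M W D {x..}) = 1"
  then have AE1: "AE \<omega> in M. exit_time W D \<omega> < \<infinity> \<and> x \<le> Re (W (enn2real (exit_time W D \<omega>)) \<omega>)"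
    using AE_exit_Re_event by fastforce
  define H where "H = {z. Re z < x}"
  define D' where "D' = D \<union> H"
  have "connected H" unfolding H_def by (intro convex_connected convex_halfspace_Re_lt)
  then have D': "open D'" "connected D'" "0 \<in> D'"
    using D z unfolding D'_def H_def by (auto intro!: connected_Un open_Un open_halfspace_Re_lt)
  define p where "p = complex_of_real (l - 1)"
  have lx: "l < x" using left[OF z(1)] z(2) by simp
  have far: "w \<notin> D" if "w \<in> ball p 1" for w
  proof
    assume "w \<in> D"
    moreover have "\<bar>Re (w - p)\<bar> < 1"
      using that abs_Re_le_cmod[of "w - p"] by (simp add: dist_norm norm_minus_commute)
    ultimately show False using left[of w] by (simp add: p_def)
  qed
  have "p \<in> D'" using lx by (simp add: D'_def H_def p_def)
  then obtain T where T: "0 \<le> T"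
    "0 < prob {\<omega> \<in> space M. (\<forall>s\<in>{0..T}. W s \<omega> \<in> D') \<and> W T \<omega> \<in> ball p 1}"
    using reachable_everywhere[OF D', of p, unfolded reachable_def, rule_format, OF _ zero_less_one] by blast
  have "AE \<omega> in M. \<omega> \<notin> {\<omega> \<in> space M. (\<forall>s\<in>{0..T}. W s \<omega> \<in> D') \<and> W T \<omega> \<in> ball p 1}"
    using AE1
  proof eventually_elim
    fix \<omega> assume ex: "exit_time W D \<omega> < \<infinity> \<and> x \<le> Re (W (enn2real (exit_time W D \<omega>)) \<omega>)"
    show "\<omega> \<notin> {\<omega> \<in> space M. (\<forall>s\<in>{0..T}. W s \<omega> \<in> D') \<and> W T \<omega> \<in> ball p 1}"
    proof
      assume \<omega>: "\<omega> \<in> {\<omega> \<in> space M. (\<forall>s\<in>{0..T}. W s \<omega> \<in> D') \<and> W T \<omega> \<in> ball p 1}"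
      define \<tau> where "\<tau> = enn2real (exit_time W D \<omega>)"
      have \<tau>: "0 \<le> \<tau>" "W \<tau> \<omega> \<notin> D" "\<And>s. 0 \<le> s \<Longrightarrow> s < \<tau> \<Longrightarrow> W s \<omega> \<in> D"
        using exit_time_finite[OF D(1)] \<omega> ex unfolding \<tau>_def by auto
      have "W T \<omega> \<notin> D" using far \<omega> by blast
      then have "\<tau> \<le> T" using \<tau>(3)[OF T(1)] by (rule contrapos_np) simp
      then have "W \<tau> \<omega> \<in> D'" using \<omega> \<tau>(1) by auto
      then have "Re (W \<tau> \<omega>) < x" using \<tau>(2) by (auto simp: D'_def H_def)
      then show False using ex by (simp add: \<tau>_def)
    qed
  qed
  then have "prob {\<omega> \<in> space M. (\<forall>s\<in>{0..T}. W s \<omega> \<in> D') \<and> W T \<omega> \<in> ball p 1} = 0"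
    using staying_hit_event[OF D'(1) T(1), of "ball p 1"] by (subst prob_eq_0) auto
  then show False using T(2) by simp
qed

text \<open>
  The motion visits the part of \<open>D\<close> to the left of \<open>x\<close> before its exit with positive probability, which
  optional stopping excludes if it almost surely exits to the right of \<open>x\<close>.
\<close>

lemma exit_left_of_level_if_finite_mean:
  assumes D: "open D" "connected D" "0 \<in> D" and fin: "(\<integral>\<^sup>+ \<omega>. exit_time W D \<omega> \<partial>M) < \<infinity>"
    and z: "z \<in> D" "Re z < x"
  shows "prob (exit_Re_event M W D {x..}) \<noteq> 1"
proof
  assume "prob (exit_Re_event M W D {x..}) = 1"
  then have "AE \<omega> in M. x \<le> Re (W (enn2real (exit_time W D \<omega>)) \<omega>)"
    using AE_exit_Re_event by fastforce
  note zero = stopped_Re_lower_bound[OF D(1) fin this]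
  obtain T where T: "0 \<le> T"
    "0 < prob {\<omega> \<in> space M. (\<forall>s\<in>{0..T}. W s \<omega> \<in> D) \<and> W T \<omega> \<in> ball z (x - Re z)}"
    using reachable_everywhere[OF D z(1), unfolded reachable_def, rule_format, of "x - Re z"] z(2) by auto
  have "ball z (x - Re z) \<subseteq> {w. Re w < x}"
  proof safe
    fix w assume "w \<in> ball z (x - Re z)"
    then show "Re w < x" using abs_Re_le_cmod[of "w - z"] by (simp add: dist_norm norm_minus_commute)
  qed
  then have "prob {\<omega> \<in> space M. (\<forall>s\<in>{0..T}. W s \<omega> \<in> D) \<and> W T \<omega> \<in> ball z (x - Re z)}
      \<le> prob {\<omega> \<in> space M. (\<forall>s\<in>{0..T}. W s \<omega> \<in> D) \<and> W T \<omega> \<in> {w. Re w < x}}"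
    using staying_hit_event[OF D(1) T(1) borel_open[OF open_halfspace_Re_lt]]
    by (intro finite_measure_mono) blast+
  then show False using T zero[OF T(1)] by simp
qed

lemma Sup_exit_level_eq_left_end:
  fixes a b :: ereal
  assumes D: "open D" "connected D" "0 \<in> D" and ab: "a < 0" "0 < b"
    and proj: "Re ` D = {x. a < ereal x \<and> ereal x < b}"
    and bdd: "a > -\<infinity> \<or> (\<integral>\<^sup>+ \<omega>. exit_time W D \<omega> \<partial>M) < \<infinity>"
  shows "Sup (ereal ` {x. prob (exit_Re_event M W D {x..}) = 1}) = a"
proof -
  have point: "\<exists>z\<in>D. Re z < x" if x: "a < ereal x" for x
  proof -
    have "a < ereal (min x 0)" using x ab by (auto simp: min_def zero_ereal_def)
    then obtain y where y: "a < ereal y" "ereal y < ereal (min x 0)" using ereal_dense2 by blast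
    then have "ereal y < 0" by (simp add: zero_ereal_def)
    then have "ereal y < b" using ab(2) by (rule less_trans)
    then have "y \<in> Re ` D" using y by (simp add: proj)
    then show ?thesis using y by auto
  qed
  have inD: "a < ereal (Re z)" if "z \<in> D" for z
  proof -
    have "Re z \<in> Re ` D" using that by blast
    then show ?thesis by (simp add: proj)
  qed
  have le: "ereal x \<le> a" if "prob (exit_Re_event M W D {x..}) = 1" for x
  proof (rule ccontr)
    assume "\<not> ereal x \<le> a"
    then obtain z where z: "z \<in> D" "Re z < x" using point by (auto simp: not_le)
    show False
    proof (cases a)
      case (real l)
      then have "\<And>z. z \<in> D \<Longrightarrow> l < Re z" using inD by simp
      from exit_left_of_level_if_bounded_left[OF D this z] that show False by simp
    next
      case MInf
      then show False using exit_left_of_level_if_finite_mean[OF D _ z] bdd that by simp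
    qed (use ab in simp)
  qed
  show ?thesis
  proof (rule antisym)
    show "Sup (ereal ` {x. prob (exit_Re_event M W D {x..}) = 1}) \<le> a"
      using le by (auto intro: Sup_least)
    show "a \<le> Sup (ereal ` {x. prob (exit_Re_event M W D {x..}) = 1})"
    proof (cases a)
      case (real l)
      then have "\<And>z. z \<in> D \<Longrightarrow> l < Re z" using inD by simp
      then have "prob (exit_Re_event M W D {l..}) = 1" by (rule prob_exit_Re_event_left_end[OF D(1,3)])
      then show ?thesis unfolding real by (intro Sup_upper) auto
    qed (use ab in auto)
  qed
qed

end

section \<open>Reflection and the right end\<close>

text \<open>
  The statement about the right end follows from the one about the left end by reflecting the motion
  and the domain in the origin.
\<close>

lemma standard_brownian_motion_uminus:
  assumes "standard_brownian_motion M B"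
  shows "standard_brownian_motion M (\<lambda>t \<omega>. - B t \<omega>)"
proof -
  interpret standard_brownian_motion M B by fact
  show ?thesis
  proof
    fix s t :: real assume st: "0 \<le> s" "s < t"
    then show "distributed M lborel (\<lambda>\<omega>. - B t \<omega> - - B s \<omega>) (normal_density 0 (sqrt (t - s)))"
      using normal_density_affine[OF normal_increments[OF st], of "-1" 0] by (simp add: algebra_simps)
  next
    fix u :: "nat \<Rightarrow> real" and n assume u: "0 \<le> u 0" "mono u"
    have "indep_vars (\<lambda>_. borel) (\<lambda>i \<omega>. - (B (u (Suc i)) \<omega> - B (u i) \<omega>)) {..<n}"
      by (rule indep_vars_compose2[OF indep_increments[OF u]]) auto
    then show "indep_vars (\<lambda>_. borel) (\<lambda>i \<omega>. - B (u (Suc i)) \<omega> - - B (u i) \<omega>) {..<n}"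
      by (simp add: algebra_simps)
  qed (use random_variable start continuous_paths in \<open>auto intro: continuous_on_minus\<close>)
qed

lemma complex_brownian_motion_uminus:
  assumes "complex_brownian_motion M W"
  shows "complex_brownian_motion M (\<lambda>t \<omega>. - W t \<omega>)"
proof -
  interpret complex_brownian_motion M W by fact
  have m: "(\<lambda>f. \<lambda>t\<in>{0..}. - f t) \<in> measurable (PiM {0..} (\<lambda>_. borel)) (PiM {0..} (\<lambda>_. borel :: real measure))"
    by (intro measurable_restrict borel_measurable_uminus measurable_component_singleton) auto
  have r: "(\<lambda>t\<in>{0..}. - (\<lambda>t\<in>{0..}. f t) t) = (\<lambda>t\<in>{0..}. - f t)" for f :: "real \<Rightarrow> real"
    by (auto simp: restrict_def)
  have ind: "indep_var (PiM {0..} (\<lambda>_. borel)) (\<lambda>\<omega>. \<lambda>t\<in>{0..}. Re (- W t \<omega>))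
      (PiM {0..} (\<lambda>_. borel)) (\<lambda>\<omega>. \<lambda>t\<in>{0..}. Im (- W t \<omega>))"
    using indep_var_compose[OF indep_Re_Im m m] by (simp only: comp_def r uminus_complex.sel)
  show ?thesis
    using standard_brownian_motion_uminus[OF Re_brownian] standard_brownian_motion_uminus[OF Im_brownian]
    by (intro complex_brownian_motion.intro complex_brownian_motion_axioms.intro prob_space_axioms ind) simp_all
qed

lemma exit_time_uminus: "exit_time (\<lambda>t \<omega>. - W t \<omega>) (uminus ` D) = exit_time W D"
proof -
  have "- z \<in> uminus ` D \<longleftrightarrow> z \<in> D" for z :: complex by force
  then show ?thesis by (simp add: exit_time_def fun_eq_iff)
qed

lemma exit_Re_event_uminus:
  "exit_Re_event M (\<lambda>t \<omega>. - W t \<omega>) (uminus ` D) {x..} = exit_Re_event M W D {..-x}"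
  unfolding exit_Re_event_def exit_time_uminus by auto

theorem theorem4:
  fixes M :: "'w measure" and W :: "real \<Rightarrow> 'w \<Rightarrow> complex"
    and D :: "complex set" and a b \<alpha> \<beta> :: ereal
  assumes "complex_brownian_motion M W"
    and "open D" and "connected D" and "simply_connected D" and "D \<noteq> UNIV" and "0 \<in> D"
    and "a < 0" and "0 < b"
    and "Re ` D = {x. a < ereal x \<and> ereal x < b}"
    and "\<alpha> = Sup (ereal ` {x. measure M (exit_Re_event M W D {x..}) = 1})"
    and "\<beta> = Inf (ereal ` {x. measure M (exit_Re_event M W D {..x}) = 1})"
  shows "(a > -\<infinity> \<longrightarrow> \<alpha> = a) \<and> (b < \<infinity> \<longrightarrow> \<beta> = b) \<and>
         ((\<integral>\<^sup>+ \<omega>. exit_time W D \<omega> \<partial>M) < \<infinity> \<longrightarrow> \<alpha> = a \<and> \<beta> = b)"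
proof -
  interpret W: complex_brownian_motion M W by fact
  interpret W': complex_brownian_motion M "\<lambda>t \<omega>. - W t \<omega>"
    by (rule complex_brownian_motion_uminus) fact
  have left: "\<alpha> = a" if "a > -\<infinity> \<or> (\<integral>\<^sup>+ \<omega>. exit_time W D \<omega> \<partial>M) < \<infinity>"
    unfolding assms(10) by (rule W.Sup_exit_level_eq_left_end) (use assms that in auto)
  have right: "\<beta> = b" if "b < \<infinity> \<or> (\<integral>\<^sup>+ \<omega>. exit_time W D \<omega> \<partial>M) < \<infinity>"
  proof -
    define D' where "D' = uminus ` D"
    have "Re ` D' = uminus ` Re ` D" by (auto simp: D'_def image_image)
    also have "\<dots> = {x. - b < ereal x \<and> ereal x < - a}"
    proof (intro set_eqI iffI)
      fix x assume "x \<in> uminus ` Re ` D"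
      then have "- x \<in> Re ` D" by force
      then show "x \<in> {x. - b < ereal x \<and> ereal x < - a}"
        unfolding assms(9) using ereal_uminus_less_reorder[of b "ereal x"] ereal_less_uminus_reorder[of "ereal x" a] by simp
    next
      fix x assume "x \<in> {x. - b < ereal x \<and> ereal x < - a}"
      then have "- x \<in> Re ` D"
        unfolding assms(9) using ereal_uminus_less_reorder[of b "ereal x"] ereal_less_uminus_reorder[of "ereal x" a] by simp
      then show "x \<in> uminus ` Re ` D" by force
    qed
    finally have proj: "Re ` D' = {x. - b < ereal x \<and> ereal x < - a}" .
    have D': "open D'" "connected D'" "0 \<in> D'"
      unfolding D'_def using assms(2,3,6)
      by (auto intro!: open_negations connected_continuous_image continuous_intros image_eqI[of _ _ 0])
    have "Sup (ereal ` {x. measure M (exit_Re_event M (\<lambda>t \<omega>. - W t \<omega>) D' {x..}) = 1}) = - b"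
      by (rule W'.Sup_exit_level_eq_left_end[OF D' _ _ proj])
        (use assms(7,8) that in \<open>auto simp: D'_def exit_time_uminus ereal_uminus_less_reorder\<close>)
    moreover have "ereal ` {x. measure M (exit_Re_event M (\<lambda>t \<omega>. - W t \<omega>) D' {x..}) = 1}
        = uminus ` ereal ` {x. measure M (exit_Re_event M W D {..x}) = 1}"
      unfolding D'_def exit_Re_event_uminus
      by (force simp: image_image image_iff intro: exI[of _ "- _"])
    ultimately show ?thesis unfolding assms(11) by (simp add: ereal_Sup_uminus_image_eq)
  qed
  show ?thesis using left right by blast
qed

end
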